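(* The longest overlap-free word over the ternary alphabet $\{0,1,2\}$ whose curling-number transform is $(7/3)$-free has length $84$. That is, there exists an overlap-free ternary word $x$ of length $84$ with $C(x)$ being $(7/3)$-free, and there is no such word of length greater than $84$.
   Context: Words are indexed from $0$: a finite word of length $n$ is $x = x[0]x[1]\cdots x[n-1]$, and $x[i..j]$ denotes the factor (contiguous block) $x[i]\cdots x[j]$. A finite word $x$ of length $n \ge 1$ has period $p$, $1\le p\le n$, if $x[i]=x[i+p]$ for all $0\le i<n-p$; its exponent is $n/p$ where $p$ is its least period. A word is $\alpha$-free if it has no nonempty finite factor of exponent at least $\alpha$. An overlap is a word of the form $a x a x a$ with $a$ a single letter and $x$ a possibly empty word; a word is overlap-free if it contains no overlap as a factor (equivalently, it has no factor of exponent strictly greater than $2$). The curling number of a nonempty finite word $u$ is the largest integer $k \ge 1$ such that $u = y z^k$ for some (possibly empty) word $y$ and some nonempty word $z$. For a finite or infinite word $x$, the curling-number transform $C(x)$ is the word over the positive integers, of the same length as $x$, whose $i$-th letter $C(x)[i]$ is the curling number of the prefix $x[0..i]$. *)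

theory Defs
  imports Complex_Main "HOL-Library.Sublist"
begin

text \<open>
  A finite word is a list, indexed from 0; \<^const>\<open>sublist\<close> is the contiguous factor relation.
\<close>

definition has_period :: "'a list \<Rightarrow> nat \<Rightarrow> bool" where
  "has_period x p \<longleftrightarrow>
     1 \<le> p \<and> p \<le> length x \<and> (\<forall>i < length x - p. x ! i = x ! (i + p))"

text \<open>Meaningful for nonempty words only: the empty word has no period.\<close>

definition least_period :: "'a list \<Rightarrow> nat" where
  "least_period x = (LEAST p. has_period x p)"

definition word_exponent :: "'a list \<Rightarrow> real" where
  "word_exponent x = real (length x) / real (least_period x)"

definition exponent_free :: "real \<Rightarrow> 'a list \<Rightarrow> bool" where
  "exponent_free \<alpha> x \<longleftrightarrow> \<not> (\<exists>w. w \<noteq> [] \<and> sublist w x \<and> word_exponent w \<ge> \<alpha>)"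

definition overlap :: "'a list \<Rightarrow> bool" where
  "overlap w \<longleftrightarrow> (\<exists>a x. w = [a] @ x @ [a] @ x @ [a])"

definition overlap_free :: "'a list \<Rightarrow> bool" where
  "overlap_free x \<longleftrightarrow> \<not> (\<exists>w. overlap w \<and> sublist w x)"

text \<open>
  For nonempty \<open>u\<close> the greatest element exists: \<open>k = 1\<close> qualifies, and \<open>z \<noteq> []\<close> forces
  \<open>k \<le> length u\<close>.
\<close>

definition curling_number :: "'a list \<Rightarrow> nat" where
  "curling_number u =
     (GREATEST k. 1 \<le> k \<and> (\<exists>y z. z \<noteq> [] \<and> u = y @ concat (replicate k z)))"

definition curling_transform :: "'a list \<Rightarrow> nat list" where
  "curling_transform x = map (\<lambda>i. curling_number (take (Suc i) x)) [0..<length x]"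

end

theory Submission
  imports Defs
begin

text \<open>
  The words in question form a finite tree with about 1.6 million nodes up to renaming of the
  letters, but what can follow a word depends essentially on its last few letters and its last few
  curling numbers.  A list of about 3200 such pairs (states), closed under appending a letter,
  contains one that matches every word in question.

  The only nonlocal ingredient is that the curling number \<open>1\<close> requires the absence of squares of
  every period.  The periods up to 12 are visible in the states.  A square of larger period \<open>p\<close> would
  make the curling numbers nearly periodic with period \<open>p\<close>, because short squares are repeated along
  with the letters.  The states show that the curling numbers avoid two factors and six prefixes,
  and only 2719 \<open>7/3\<close>-free words over \<open>{1, 2}\<close> do so.  Searching them shows that their length is at
  most 84 and that near-periodicity leaves 21 contexts for a long square, with period 14, 16 or 24;
  these are excluded by the known letters of the states.
\<close>

section \<open>Words read backwards\<close>

text \<open>The curling number at a position depends on the whole word before it, whereas a state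
  knows only a bounded part of that word: it can confirm \<open>Two\<close>, but in general not
  \<open>One\<close>. Therefore the two finite computations feed each other within a single
  induction over the letters. The states show that the curling numbers so far are admissible; the
  search over admissible curling words then tells which long squares could end at the next letter;
  and this licenses the \<open>One\<close> recorded by the next state. The bound 84 comes from the
  search over curling words, while the list of states only has to be closed. Copying squares along a
  long period requires every \<open>Two\<close> to come from a square of bounded length, which is
  carried along as the third part of the invariant \<open>sound\<close>. For the upper bound each
  test has to be sound in one direction only, so the computed tables are hints that are checked and
  not assumed.\<close>

text \<open>From here on words are reversed, so that the most recent letter is the head of the list and
  a repetition at the end of a word becomes one at the beginning of the list.\<close>

definition rep :: "nat \<Rightarrow> nat \<Rightarrow> 'a list \<Rightarrow> bool" where
  "rep p m r \<longleftrightarrow> 1 \<le> p \<and> m + p \<le> length r \<and> (\<forall>j<m. r ! j = r ! (j + p))"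

text \<open>An overlap-free word contains no cube, so its curling numbers are \<open>1\<close> and \<open>2\<close>, and a \<open>2\<close>
  means that a square ends there.  \<open>Start\<close> is an end marker for the position before the first letter.\<close>

datatype curl = One | Two | Start

fun curls :: "'a list \<Rightarrow> curl list" where
  "curls [] = []"
| "curls (a # r) = (if \<exists>p. rep p p (a # r) then Two else One) # curls r"

text \<open>A factor of length \<open>m + p\<close> and period \<open>p\<close> has exponent at least \<open>7/3\<close> iff
  \<open>4 * p \<le> 3 * m\<close>.\<close>

definition good :: "'a list \<Rightarrow> bool" where
  "good r \<longleftrightarrow> (\<forall>k p. \<not> rep p (Suc p) (drop k r)) \<and>
     (\<forall>k p m. 4 * p \<le> 3 * m \<longrightarrow> \<not> rep p m (drop k (curls r)))"

lemma length_curls [simp]: "length (curls r) = length r"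
  by (induction r) auto

lemma drop_curls: "drop k (curls r) = curls (drop k r)"
proof (induction r arbitrary: k)
  case (Cons a r)
  then show ?case by (cases k) auto
qed simp

lemma Start_notin_curls: "Start \<notin> set (curls r)"
  by (induction r) auto

lemma curls_nth:
  assumes "k < length r"
  shows "curls r ! k = (if \<exists>p. rep p p (drop k r) then Two else One)"
proof -
  obtain a s where as: "drop k r = a # s"
    using assms by (metis Cons_nth_drop_Suc)
  have "curls r ! k = hd (drop k (curls r))"
    using assms by (simp add: hd_drop_conv_nth)
  then show ?thesis
    by (simp add: drop_curls as del: drop_eq_Nil)
qed

lemma good_Cons: "good (a # r) \<Longrightarrow> good r"
  unfolding good_def by (metis curls.simps(2) drop_Suc_Cons)

lemma rep_append: "rep p m u \<Longrightarrow> rep p m (u @ v)"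
  unfolding rep_def by (auto simp: nth_append)

lemma rep_map:
  assumes "inj f"
  shows "rep p m (map f r) \<longleftrightarrow> rep p m r"
  unfolding rep_def using assms by (auto simp: inj_eq)

lemma sublist_rev_drop: "sublist (rev (take n (drop k (rev x)))) x"
proof -
  have "sublist (take n (drop k (rev x))) (rev x)"
    by (metis append_take_drop_id sublist_def)
  then show ?thesis
    using sublist_rev_left by blast
qed

lemma sublist_rev_imp_drop:
  assumes "sublist w x"
  obtains k v where "drop k (rev x) = rev w @ v"
proof -
  obtain u v where "x = u @ w @ v"
    using assms unfolding sublist_def by blast
  then have "drop (length v) (rev x) = rev w @ rev u" by simp
  then show thesis using that by blast
qed

section \<open>Overlaps and exponents in terms of \<open>rep\<close>\<close>

lemma overlap_free_iff: "overlap_free x \<longleftrightarrow> (\<forall>k p. \<not> rep p (Suc p) (drop k (rev x)))"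
proof
  assume free: "overlap_free x"
  show "\<forall>k p. \<not> rep p (Suc p) (drop k (rev x))"
  proof (intro allI notI)
    fix k p assume r: "rep p (Suc p) (drop k (rev x))"
    define w where "w = take (Suc p + p) (drop k (rev x))"
    have len: "length w = Suc p + p" and p: "1 \<le> p"
      using r by (auto simp: rep_def w_def)
    have per: "w ! j = w ! (j + p)" if "j < Suc p" for j
      using r that by (auto simp: rep_def w_def)
    define y where "y = take (p - 1) (drop 1 w)"
    have leny: "length y = p - 1" using len by (simp add: y_def)
    have ynth: "y ! i = w ! Suc i" if "i < p - 1" for i
      using that len by (simp add: y_def)
    \<comment> \<open>The period makes the entries at \<open>0\<close>, \<open>p\<close> and
      \<open>p + p\<close> equal, and likewise the two blocks of length \<open>p - 1\<close> between
      them.\<close>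
    have "w = [w ! 0] @ y @ [w ! 0] @ y @ [w ! 0]"
    proof (rule nth_equalityI)
      show "length w = length ([w ! 0] @ y @ [w ! 0] @ y @ [w ! 0])"
        using len leny p by simp
    next
      fix i assume i: "i < length w"
      have wp: "w ! p = w ! 0" "w ! (p + p) = w ! 0"
        using per[of 0] per[of p] by auto
      consider "i = 0" | "1 \<le> i" "i < p" | "i = p" | "p < i" "i < p + p" | "i = p + p"
        using i len by linarith
      then show "w ! i = ([w ! 0] @ y @ [w ! 0] @ y @ [w ! 0]) ! i"
      proof cases
        case 2
        then have "i - 1 < p - 1" by simp
        with 2 show ?thesis
          using leny ynth[of "i - 1"] by (simp add: nth_append nth_Cons')
      next
        case 3
        then show ?thesis using leny p wp by (simp add: nth_append nth_Cons')
      next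
        case 4
        then have a: "i - p - 1 < p - 1" by simp
        have "w ! i = w ! (i - p)" using per[of "i - p"] 4 by simp
        also have "\<dots> = y ! (i - p - 1)" using ynth[OF a] 4 by (simp add: Suc_diff_Suc)
        finally have "w ! i = y ! (i - p - 1)" .
        moreover have "i - 1 - (p - 1) = i - p" "i - 1 - (p - 1) - 1 = i - p - 1" using p 4 by auto
        ultimately show ?thesis using 4 leny p a by (auto simp: nth_append nth_Cons')
      next
        case 5
        then show ?thesis using leny p wp by (auto simp: nth_append nth_Cons')
      qed simp
    qed
    then have "rev w = [w ! 0] @ rev y @ [w ! 0] @ rev y @ [w ! 0]"
      by (metis append.assoc rev_append rev_singleton_conv)
    then have "overlap (rev w)" unfolding overlap_def by blast
    then show False
      using free sublist_rev_drop[of "Suc p + p" k x] unfolding overlap_free_def w_def by blast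
  qed
next
  assume none: "\<forall>k p. \<not> rep p (Suc p) (drop k (rev x))"
  show "overlap_free x"
    unfolding overlap_free_def
  proof (intro notI, elim exE conjE)
    fix w assume "overlap w" and sub: "sublist w x"
    then obtain a y where w: "w = [a] @ y @ [a] @ y @ [a]"
      unfolding overlap_def by blast
    \<comment> \<open>The reversed overlap is two copies of \<open>z\<close> followed by the first
      letter of a third, so the length of \<open>z\<close> is a period.\<close>
    define z where "z = a # rev y"
    have rw: "rev w = z @ z @ [a]" by (simp add: w z_def)
    have z0: "z ! 0 = a" "z \<noteq> []" by (auto simp: z_def)
    have "rep (length z) (Suc (length z)) (rev w)"
      unfolding rep_def rw
    proof (intro conjI allI impI)
      fix j assume "j < Suc (length z)"
      then consider "j < length z" | "j = length z" by linarith
      then show "(z @ z @ [a]) ! j = (z @ z @ [a]) ! (j + length z)"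
        by cases (auto simp: nth_append z0)
    qed (auto simp: z_def)
    moreover obtain k v where "drop k (rev x) = rev w @ v"
      using sublist_rev_imp_drop[OF sub] .
    ultimately show False
      using none rep_append by metis
  qed
qed

lemma least_period:
  assumes "w \<noteq> []"
  shows "has_period w (least_period w)"
  unfolding least_period_def
  by (rule LeastI[of _ "length w"]) (use assms in \<open>auto simp: has_period_def Suc_le_eq\<close>)

lemma exponent_free_iff:
  "exponent_free (7/3) c \<longleftrightarrow> (\<forall>k p m. 4 * p \<le> 3 * m \<longrightarrow> \<not> rep p m (drop k (rev c)))"
proof
  assume free: "exponent_free (7/3) c"
  show "\<forall>k p m. 4 * p \<le> 3 * m \<longrightarrow> \<not> rep p m (drop k (rev c))"
  proof (intro allI impI notI)
    fix k p m assume pm: "4 * p \<le> 3 * m" and r: "rep p m (drop k (rev c))"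
    define v where "v = take (m + p) (drop k (rev c))"
    have len: "length v = m + p" and p: "1 \<le> p" and per: "\<And>j. j < m \<Longrightarrow> v ! j = v ! (j + p)"
      using r by (auto simp: rep_def v_def)
    have hp: "has_period (rev v) p"
      unfolding has_period_def
    proof (intro conjI allI impI)
      fix i assume "i < length (rev v) - p"
      then have i: "i < m" using len by simp
      have "rev v ! i = v ! (m - 1 - i + p)"
        using i len p by (simp add: rev_nth)
      also have "\<dots> = v ! (m - 1 - i)" using per[of "m - 1 - i"] i by simp
      also have "\<dots> = rev v ! (i + p)" using i len by (simp add: rev_nth)
      finally show "rev v ! i = rev v ! (i + p)" .
    qed (use p len in auto)
    have ne: "rev v \<noteq> []" using len p by auto
    \<comment> \<open>The exponent is taken with the least period, so exhibiting any period
      \<open>p\<close> bounds it from below by \<open>(m + p) / p\<close>.\<close>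
    have "least_period (rev v) \<le> p"
      unfolding least_period_def using hp by (rule Least_le)
    moreover have "1 \<le> least_period (rev v)"
      using least_period[OF ne] by (simp add: has_period_def)
    moreover have "7 / 3 \<le> real (m + p) / real p"
      using pm p by (simp add: field_simps)
    ultimately have "7 / 3 \<le> word_exponent (rev v)"
      unfolding word_exponent_def
      by (smt (verit) frac_le len length_rev of_nat_0_le_iff of_nat_1 of_nat_mono)
    then show False
      using free ne sublist_rev_drop[of "m + p" k c] unfolding exponent_free_def v_def by blast
  qed
next
  assume none: "\<forall>k p m. 4 * p \<le> 3 * m \<longrightarrow> \<not> rep p m (drop k (rev c))"
  show "exponent_free (7/3) c"
    unfolding exponent_free_def
  proof (intro notI, elim exE conjE)
    fix w assume ne: "w \<noteq> []" and sub: "sublist w c" and ex: "7 / 3 \<le> word_exponent w"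
    define p where "p = least_period w"
    define m where "m = length w - p"
    have hp: "1 \<le> p" "p \<le> length w" "\<And>i. i < m \<Longrightarrow> w ! i = w ! (i + p)"
      using least_period[OF ne] by (auto simp: has_period_def p_def m_def)
    have "7 * real p \<le> 3 * real (length w)"
      using ex hp(1) by (simp add: word_exponent_def p_def[symmetric] field_simps)
    then have "7 * p \<le> 3 * length w" by linarith
    then have pm: "4 * p \<le> 3 * m" using hp by (simp add: m_def)
    have "rep p m (rev w)"
      unfolding rep_def
    proof (intro conjI allI impI)
      fix j assume j: "j < m"
      have "rev w ! j = w ! (m - 1 - j + p)"
        using j hp by (simp add: rev_nth m_def)
      also have "\<dots> = w ! (m - 1 - j)" using hp(3)[of "m - 1 - j"] j by simp
      also have "\<dots> = rev w ! (j + p)" using j hp by (simp add: rev_nth m_def)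
      finally show "rev w ! j = rev w ! (j + p)" .
    qed (use hp in \<open>auto simp: m_def\<close>)
    moreover obtain k v where "drop k (rev c) = rev w @ v"
      using sublist_rev_imp_drop[OF sub] .
    ultimately show False
      using none pm rep_append by metis
  qed
qed

lemma square_iff: "rep p p r \<longleftrightarrow> (\<exists>z v. z \<noteq> [] \<and> length z = p \<and> r = z @ z @ v)"
proof
  assume r: "rep p p r"
  define z where "z = take p r"
  have "take p (drop p r) = z"
    unfolding z_def by (rule nth_equalityI) (use r in \<open>auto simp: rep_def add.commute\<close>)
  then have "r = z @ z @ drop (p + p) r"
    unfolding z_def by (metis append_take_drop_id drop_drop)
  moreover have "length z = p" "z \<noteq> []" using r by (auto simp: rep_def z_def)
  ultimately show "\<exists>z v. z \<noteq> [] \<and> length z = p \<and> r = z @ z @ v" by blast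
next
  assume "\<exists>z v. z \<noteq> [] \<and> length z = p \<and> r = z @ z @ v"
  then show "rep p p r"
    by (auto simp: rep_def nth_append Suc_le_eq)
qed

lemma overlap_free_sublist: "overlap_free x \<Longrightarrow> sublist u x \<Longrightarrow> overlap_free u"
  unfolding overlap_free_def using sublist_order.order_trans by blast

section \<open>Curling numbers of overlap-free words\<close>

lemma curling_number_overlap_free:
  assumes free: "overlap_free u" and ne: "u \<noteq> []"
  shows "curling_number u = (if \<exists>p. rep p p (rev u) then 2 else 1)"
proof -
  define P where "P k \<longleftrightarrow> 1 \<le> k \<and> (\<exists>y z. z \<noteq> [] \<and> u = y @ concat (replicate k z))" for k
  have le2: "k \<le> 2" if "P k" for k
  proof (rule ccontr)
    assume "\<not> k \<le> 2"
    then obtain i where k: "k = i + 3"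
      by (metis add.commute add_leE le_Suc_ex not_less_eq_eq numeral_2_eq_2 numeral_3_eq_3)
    obtain y z where "z \<noteq> []" and u: "u = y @ concat (replicate k z)"
      using \<open>P k\<close> unfolding P_def by blast
    then obtain a x where z: "z = a # x" by (cases z) auto
    have "replicate k z = replicate i z @ [z, z, z]"
      unfolding k replicate_add by (simp add: numeral_3_eq_3)
    \<comment> \<open>A cube of \<open>a # x\<close> contains an overlap: two copies and the first
      letter of the third.\<close>
    then have "u = (y @ concat (replicate i z)) @ ([a] @ x @ [a] @ x @ [a]) @ x"
      by (simp add: u z)
    then have "sublist ([a] @ x @ [a] @ x @ [a]) u" unfolding sublist_def by blast
    then show False using free unfolding overlap_free_def overlap_def by blast
  qed
  have P1: "P 1" unfolding P_def using ne by (intro conjI exI[of _ "[]"] exI[of _ u]) auto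
  have P2: "P 2 \<longleftrightarrow> (\<exists>p. rep p p (rev u))"
  proof
    assume "P 2"
    then obtain y z where "z \<noteq> []" "u = y @ z @ z"
      by (auto simp: P_def numeral_2_eq_2)
    then have "rev z \<noteq> [] \<and> length (rev z) = length z \<and> rev u = rev z @ rev z @ rev y" by simp
    then show "\<exists>p. rep p p (rev u)" using square_iff by blast
  next
    assume "\<exists>p. rep p p (rev u)"
    then obtain z v where "z \<noteq> []" "rev u = z @ z @ v" using square_iff by blast
    then have "rev z \<noteq> []" "u = rev v @ concat (replicate 2 (rev z))"
      by (auto simp: numeral_2_eq_2) (metis append.assoc rev_append rev_rev_ident)
    then show "P 2" unfolding P_def by (metis one_le_numeral)
  qed
  show ?thesis
  proof (cases "\<exists>p. rep p p (rev u)")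
    case True
    then have "(GREATEST k. P k) = 2" using P2 le2 by (intro Greatest_equality) auto
    then show ?thesis using True by (simp add: curling_number_def P_def)
  next
    case False
    have "k \<le> 1" if "P k" for k
    proof -
      have "k \<noteq> 2" using that False P2 by blast
      with le2[OF that] show ?thesis by linarith
    qed
    then have "(GREATEST k. P k) = 1" using P1 by (intro Greatest_equality) auto
    then show ?thesis using False by (simp add: curling_number_def P_def)
  qed
qed

text \<open>\<open>Start\<close> gets a value other than 1 and 2 so that the translation is
  injective and preserves repetitions in both directions.\<close>

fun curl_value :: "curl \<Rightarrow> nat" where
  "curl_value Start = 0"
| "curl_value One = 1"
| "curl_value Two = 2"

lemma inj_curl_value: "inj curl_value"
proof (rule injI)
  fix a b show "curl_value a = curl_value b \<Longrightarrow> a = b" by (cases a; cases b) auto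
qed

lemma curling_transform_overlap_free:
  assumes "overlap_free x"
  shows "rev (curling_transform x) = map curl_value (curls (rev x))"
proof (rule nth_equalityI)
  fix k assume "k < length (rev (curling_transform x))"
  then have k: "k < length x" by (simp add: curling_transform_def)
  define i where "i = length x - Suc k"
  have i: "i < length x" "length x - Suc i = k" using k by (auto simp: i_def)
  have pre: "rev (take (Suc i) x) = drop k (rev x)"
    using i by (simp add: rev_take)
  have "rev (curling_transform x) ! k = curling_number (take (Suc i) x)"
    using i k by (simp add: rev_nth curling_transform_def i_def)
  also have "\<dots> = (if \<exists>p. rep p p (drop k (rev x)) then 2 else 1)"
  proof -
    have "sublist (take (Suc i) x) x" using take_is_prefix prefix_imp_sublist by blast
    then have "overlap_free (take (Suc i) x)" using assms overlap_free_sublist by blast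
    moreover have "take (Suc i) x \<noteq> []" using i by auto
    ultimately show ?thesis
      using curling_number_overlap_free[of "take (Suc i) x"] unfolding pre by blast
  qed
  also have "\<dots> = map curl_value (curls (rev x)) ! k"
    using k by (simp add: curls_nth)
  finally show "rev (curling_transform x) ! k = map curl_value (curls (rev x)) ! k" .
qed (simp add: curling_transform_def)

text \<open>Overlap-freeness puts all curling numbers into {1, 2}, where \<open>curls\<close>
  records them faithfully; if \<open>x\<close> contains an overlap, both sides fail.\<close>

lemma good_iff: "good (rev x) \<longleftrightarrow> overlap_free x \<and> exponent_free (7/3) (curling_transform x)"
proof (cases "overlap_free x")
  case True
  have "exponent_free (7/3) (curling_transform x) \<longleftrightarrow>
      (\<forall>k p m. 4 * p \<le> 3 * m \<longrightarrow> \<not> rep p m (drop k (curls (rev x))))"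
    unfolding exponent_free_iff curling_transform_overlap_free[OF True] drop_map rep_map[OF inj_curl_value] ..
  then show ?thesis using True by (simp add: good_def overlap_free_iff)
qed (auto simp: good_def overlap_free_iff)

section \<open>Tests on known beginnings\<close>

text \<open>When only beginnings of the lists are known, a comparison has three outcomes.
  \<open>agree\<close> and \<open>disagree\<close> report the two that persist under every
  continuation; both fail when the known part ends too early.\<close>

fun agree :: "nat \<Rightarrow> 'a list \<Rightarrow> 'a list \<Rightarrow> bool" where
  "agree 0 u v = True"
| "agree (Suc n) (a # u) (b # v) = (a = b \<and> agree n u v)"
| "agree (Suc n) u v = False"

fun disagree :: "nat \<Rightarrow> 'a list \<Rightarrow> 'a list \<Rightarrow> bool" where
  "disagree (Suc n) (a # u) (b # v) = (a \<noteq> b \<or> disagree n u v)"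
| "disagree n u v = False"

lemma agree_iff: "agree n u v \<longleftrightarrow> n \<le> length u \<and> n \<le> length v \<and> (\<forall>j<n. u ! j = v ! j)"
proof (induction n u v rule: agree.induct)
  case (2 n a u b v)
  then show ?case by (auto simp: less_Suc_eq_0_disj)
qed auto

lemma disagree_iff: "disagree n u v \<longleftrightarrow> (\<exists>j<n. j < length u \<and> j < length v \<and> u ! j \<noteq> v ! j)"
proof (induction n u v rule: disagree.induct)
  case (1 n a u b v)
  then show ?case by (auto simp: less_Suc_eq_0_disj)
qed auto

lemma rep_iff_agree: "1 \<le> p \<Longrightarrow> 1 \<le> m \<Longrightarrow> rep p m r \<longleftrightarrow> agree m r (drop p r)"
  by (auto simp: rep_def agree_iff add.commute)

text \<open>The end marker \<open>z\<close> differs from every letter, so that running into it is a mismatch.\<close>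

lemma agree_marked:
  assumes "agree m t (drop p t)" "prefix t (y @ [z])" "z \<notin> set y" "1 \<le> p" "1 \<le> m"
  shows "rep p m y"
proof -
  have len: "m \<le> length t" "m + p \<le> length t" and eq: "\<And>j. j < m \<Longrightarrow> t ! j = t ! (p + j)"
    using assms(1,5) by (auto simp: agree_iff)
  obtain w where w: "y @ [z] = t @ w" using assms(2) by (auto simp: prefix_def)
  have eq': "(y @ [z]) ! j = (y @ [z]) ! (p + j)" if "j < m" for j
    using eq[OF that] len that unfolding w by (simp add: nth_append)
  have le: "length t \<le> Suc (length y)" using prefix_length_le[OF assms(2)] by simp
  have "m + p \<noteq> Suc (length y)"
  proof
    assume a: "m + p = Suc (length y)"
    then have "m - 1 < length y" "p + (m - 1) = length y" using assms(4,5) by auto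
    then have "y ! (m - 1) = z"
      using eq'[of "m - 1"] assms(5) by (simp add: nth_append del: add_diff_assoc)
    moreover have "m - 1 < length y" by fact
    ultimately show False using assms(3) nth_mem by blast
  qed
  then have mp: "m + p \<le> length y" using le len by simp
  have "y ! j = y ! (j + p)" if "j < m" for j
    using eq'[OF that] that mp assms(4) by (simp add: nth_append add.commute)
  then show ?thesis using mp assms(4) by (simp add: rep_def)
qed

text \<open>A visible mismatch refutes the square even if it involves the marker: the square would
  have to fit into \<open>y\<close>, before the marker. The bound \<open>m \<le> p\<close> keeps the
  mismatch among the positions that the square compares.\<close>

lemma disagree_marked:
  assumes "disagree m t (drop p t)" "m \<le> p" "prefix t (y @ [z])"
  shows "\<not> rep p p y"
proof
  assume r: "rep p p y"
  obtain j where j: "j < m" "p + j < length t" "t ! j \<noteq> t ! (p + j)"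
    using assms(1) by (auto simp: disagree_iff)
  obtain w where w: "y @ [z] = t @ w" using assms(3) by (auto simp: prefix_def)
  have "(y @ [z]) ! j \<noteq> (y @ [z]) ! (p + j)"
    using j unfolding w by (simp add: nth_append)
  moreover have "p + j < length y" "y ! j = y ! (j + p)"
    using r j assms(2) by (auto simp: rep_def)
  ultimately show False by (simp add: nth_append add.commute)
qed

lemma parallel_prefix: "parallel u v \<Longrightarrow> prefix v w \<Longrightarrow> \<not> prefix u w"
  using prefix_same_cases parallelE by metis

text \<open>The pairs \<open>(d, m)\<close> list lags as increments.\<close>

fun some_agree :: "(nat \<times> nat) list \<Rightarrow> 'a list \<Rightarrow> 'a list \<Rightarrow> bool" where
  "some_agree [] t v = False"
| "some_agree ((d, m) # ps) t v = (if agree m t (drop d v) then True else some_agree ps t (drop d v))"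

text \<open>Used with \<open>m\<close> equal to the lag, so that \<open>m + m\<close> is the length
  of the square. The lags increase, hence the first agreement has the smallest listed
  period.\<close>

fun some_short_agree :: "nat \<Rightarrow> (nat \<times> nat) list \<Rightarrow> 'a list \<Rightarrow> 'a list \<Rightarrow> bool" where
  "some_short_agree b [] t v = False"
| "some_short_agree b ((d, m) # ps) t v =
    (if agree m t (drop d v) then m + m \<le> b else some_short_agree b ps t (drop d v))"

fun lags :: "nat \<Rightarrow> (nat \<times> nat) list \<Rightarrow> (nat \<times> nat) list" where
  "lags k [] = []"
| "lags k ((d, m) # ps) = (k + d, m) # lags (k + d) ps"

lemma some_agreeD:
  "some_agree ps t (drop k t) \<Longrightarrow> \<exists>(p, m) \<in> set (lags k ps). agree m t (drop p t)"
  by (induction ps arbitrary: k) (auto simp: add.commute split: if_splits)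

lemma some_short_agreeD:
  "some_short_agree b ps t (drop k t) \<Longrightarrow>
    \<exists>(p, m) \<in> set (lags k ps). agree m t (drop p t) \<and> m + m \<le> b"
  by (induction ps arbitrary: k) (auto simp: add.commute split: if_splits)

text \<open>The lags are 1 to 7, 9 and 12: besides 1 and 2, the halves of the values of
  \<open>square_bound\<close>. If no square is visible at these lags, \<open>step_letter\<close>
  excludes all periods up to 12 before recording \<open>One\<close>, unless \<open>Two\<close> would
  be repetitive.\<close>

definition square_lags :: "(nat \<times> nat) list" where
  "square_lags = [(1, 1), (1, 2), (1, 3), (1, 4), (1, 5), (1, 6), (1, 7), (2, 9), (3, 12)]"

definition overlap_lags :: "(nat \<times> nat) list" where
  "overlap_lags = [(1, 2), (1, 3), (1, 4), (1, 5), (1, 6), (1, 7), (1, 8), (2, 10), (3, 13)]"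

text \<open>The lags are 1, 2, 3, 4, 6, 8, 12, 16 and 24, each with the least \<open>m\<close> such
  that \<open>4 * p \<le> 3 * m\<close>. They have the form 2^i or 3 * 2^i because these are the
  only periods of squares in binary 7/3-free words.\<close>

definition curl_lags :: "(nat \<times> nat) list" where
  "curl_lags = [(1, 2), (1, 3), (1, 4), (1, 6), (2, 8), (2, 11), (4, 16), (4, 22), (8, 32)]"

lemma square_lags: "(p, m) \<in> set (lags 0 square_lags) \<Longrightarrow> 1 \<le> p \<and> p \<le> 12 \<and> m = p"
  by (auto simp: square_lags_def)

lemma overlap_lags: "(p, m) \<in> set (lags 0 overlap_lags) \<Longrightarrow> 1 \<le> p \<and> m = Suc p"
  by (auto simp: overlap_lags_def)

lemma curl_lags: "(p, m) \<in> set (lags 0 curl_lags) \<Longrightarrow> 1 \<le> p \<and> 4 * p \<le> 3 * m"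
  by (auto simp: curl_lags_def)

definition repetitive :: "curl list \<Rightarrow> bool" where
  "repetitive t = some_agree curl_lags t t"

definition marked :: "'a list \<Rightarrow> curl list" where
  "marked r = curls r @ [Start]"

lemma marked_Nil [simp]: "marked [] = [Start]"
  by (simp add: marked_def)

lemma marked_Cons: "marked (a # r) = (if \<exists>p. rep p p (a # r) then Two else One) # marked r"
  by (simp add: marked_def)

lemma length_marked [simp]: "length (marked r) = Suc (length r)"
  by (simp add: marked_def)

lemma drop_marked: "k \<le> length r \<Longrightarrow> drop k (marked r) = marked (drop k r)"
  by (simp add: marked_def drop_curls)

lemma marked_nth: "k < length r \<Longrightarrow> marked r ! k = (if \<exists>p. rep p p (drop k r) then Two else One)"
  by (simp add: marked_def nth_append curls_nth)

lemma repetitive_not_good: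
  assumes "repetitive t" "prefix t (marked r)"
  shows "\<not> good r"
proof -
  obtain p m where pm: "(p, m) \<in> set (lags 0 curl_lags)" "agree m t (drop p t)"
    using some_agreeD[of curl_lags t 0] assms(1) by (auto simp: repetitive_def)
  have "rep p m (curls r)"
    by (rule agree_marked[OF pm(2) assms(2)[unfolded marked_def] Start_notin_curls])
      (use curl_lags[OF pm(1)] in auto)
  then have "rep p m (drop 0 (curls r))" by simp
  then show ?thesis using curl_lags[OF pm(1)] unfolding good_def by blast
qed

section \<open>Long squares\<close>

text \<open>Twice the largest least period of a square ending where the curling numbers, read backwards,
  begin with \<open>t\<close>; found by computer.\<close>

definition square_bound :: "curl list \<Rightarrow> nat" where
  "square_bound t =
    (if prefix [Two, Two, One, One, Two, Two, One, One, Two, One, Two, Two] t then 24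
     else if prefix [Two, Two, One, Two, One, One, Two, Two] t then 18
     else if prefix [Two, One, Two, One, One, Two, Two, One, One, Two, One, Two, Two, One, One, Two] t then 14
     else if prefix [Two, Two, One, Two, Two, One, One, Two] t then 12
     else if prefix [Two, Two, One, Two, One, One, Two, One] t then 10
     else if prefix [Two, One, Two, One, One, Two, Two, One, One, Two] t then 8
     else 6)"

text \<open>The tests in \<open>square_bound\<close> come in order of decreasing value, and a longer
  list passes every test that a shorter one passes. Hence a square short enough for the known
  beginning is short enough for the complete list.\<close>

lemma square_bound_mono: "prefix u v \<Longrightarrow> square_bound u \<le> square_bound v"
  unfolding square_bound_def by (auto dest: prefix_order.trans)

lemma square_bound_le: "square_bound t \<le> 24"
  unfolding square_bound_def by auto

text \<open>This part of the invariant justifies the computed values of \<open>square_bound\<close>: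
  it is proved anew with each letter, and it turns a \<open>Two\<close> into an actual square of
  bounded length.\<close>

definition short_squares :: "'a list \<Rightarrow> bool" where
  "short_squares r \<longleftrightarrow> (\<forall>k p. rep p p (drop k r) \<longrightarrow>
     (\<exists>q. rep q q (drop k r) \<and> q + q \<le> square_bound (drop k (marked r))))"

lemma short_squaresD:
  "short_squares r \<Longrightarrow> rep p p (drop k r) \<Longrightarrow>
    \<exists>q. rep q q (drop k r) \<and> q + q \<le> square_bound (drop k (marked r))"
  unfolding short_squares_def by blast

lemma short_squares_Cons:
  assumes "short_squares r"
    "\<And>p. rep p p (a # r) \<Longrightarrow> \<exists>q. rep q q (a # r) \<and> q + q \<le> square_bound (marked (a # r))"
  shows "short_squares (a # r)"
  unfolding short_squares_def
proof (intro allI)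
  fix k p
  show "rep p p (drop k (a # r)) \<longrightarrow>
     (\<exists>q. rep q q (drop k (a # r)) \<and> q + q \<le> square_bound (drop k (marked (a # r))))"
  proof (cases k)
    case 0
    then show ?thesis using assms(2) by simp
  next
    case (Suc k')
    show ?thesis
      using assms(1) unfolding short_squares_def Suc marked_Cons drop_Suc_Cons by blast
  qed
qed

text \<open>A square of period \<open>p\<close> repeats its first \<open>p\<close> letters, so any
  block lying within them occurs again \<open>p\<close> places further on. The second assumption
  says that the shorter square is such a block.\<close>

lemma square_shift:
  assumes "rep p p R" "j + q + q \<le> p"
  shows "rep q q (drop (j + p) R) \<longleftrightarrow> rep q q (drop j R)"
proof -
  have len: "p + p \<le> length R" and eq: "\<And>i. i < p \<Longrightarrow> R ! (i + p) = R ! i"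
    using assms(1) by (auto simp: rep_def)
  have "R ! (j + p + i) = R ! (j + i)" "R ! (j + p + (i + q)) = R ! (j + (i + q))" if "i < q" for i
    using eq[of "j + i"] eq[of "j + (i + q)"] that assms(2) by (simp_all add: ac_simps)
  then show ?thesis using len assms(2) by (auto simp: rep_def)
qed

text \<open>Meant for \<open>u\<close> and \<open>v\<close> that start \<open>j\<close> and
  \<open>j + p\<close> places into a list, with \<open>k = p - j\<close> letters of the period left.
  A square of length at most \<open>k\<close> on one side is copied to the other, so a difference
  there is contradictory; a longer square may stick out of the period, and then the difference is
  tolerated. Meeting \<open>Start\<close> is contradictory because the square of period
  \<open>p\<close> would not fit. The lists have to be complete, since truncation could lower
  \<open>square_bound\<close>.\<close>

fun refuted :: "nat \<Rightarrow> curl list \<Rightarrow> curl list \<Rightarrow> bool" where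
  "refuted (Suc k) (One # u) (One # v) = refuted k u v"
| "refuted (Suc k) (Two # u) (Two # v) = refuted k u v"
| "refuted (Suc k) (One # u) (Two # v) =
    (if square_bound (Two # v) \<le> Suc k then True else refuted k u v)"
| "refuted (Suc k) (Two # u) (One # v) =
    (if square_bound (Two # u) \<le> Suc k then True else refuted k u v)"
| "refuted (Suc k) (Start # u) v = True"
| "refuted (Suc k) (One # u) (Start # v) = True"
| "refuted (Suc k) (Two # u) (Start # v) = True"
| "refuted k u v = False"

fun prefix_of_some :: "'a list list \<Rightarrow> 'a list \<Rightarrow> bool" where
  "prefix_of_some [] t = False"
| "prefix_of_some (u # us) t = (if prefix u t then True else prefix_of_some us t)"

lemma prefix_of_some_iff: "prefix_of_some us t \<longleftrightarrow> (\<exists>u\<in>set us. prefix u t)"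
  by (induction us) auto

text \<open>The only contexts, found by computer, in which the curling numbers do not rule out a
  long square by themselves.\<close>

definition windows :: "(nat \<times> curl list list) list" where
  "windows =
    [(14,
      [[Two, One, Two, Two, One, One, Two, One, Two, Two, One, Two, One, One, Two, One, Two,
        Two, One, One, Two, Two, One, Two, One, One, Two],
       [Two, One, Two, One, One, Two, Two, One, Two, One, One, Two, One, Two, Two, One, Two,
        One, One, Two, Two, One, One, Two, One, Two, Two]]),
     (16,
      [[Two, One, One, Two, Two, One, One, Two, One, Two, Two, One, One, Two, Two, One, Two,
        One, One, Two, Two, One, One, Two, One, Two, Two, One, Two, One, One],
       [Two, One, Two, One, One, Two, Two, One, One, Two, One, Two, Two, One, One, Two, Two,
        One, Two, One, One, Two, Two, One, One, Two, One, Two, Two, One, One],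
       [One, Two, Two, One, One, Two, One, Two, Two, One, One, Two, Two, One, Two, One, One,
        Two, Two, One, One, Two, One, Two, Two, One, Two, One, One, Two, One],
       [Two, One, One, Two, Two, One, One, Two, One, Two, Two, One, One, Two, Two, One, Two,
        One, One, Two, Two, One, One, Two, One, Two, Two, One, One, Two, One],
       [Two, One, Two, Two, One, One, Two, Two, One, Two, One, One, Two, Two, One, One, Two,
        One, Two, Two, One, One, Two, Two, One, Two, One, One, Two, Two, One],
       [Two, One, Two, Two, One, One, Two, Two, One, Two, One, One, Two, Two, One, One, Two,
        One, Two, Two, One, One, Two, Two, One, Two, One, One, Two, One, Two],
       [One, Two, Two, One, One, Two, One, Two, Two, One, One, Two, Two, One, Two, One, One,
        Two, Two, One, One, Two, One, Two, Two, One, One, Two, Two, One, Two],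
       [Two, One, Two, One, One, Two, Two, One, One, Two, One, Two, Two, One, One, Two, Two,
        One, Two, One, One, Two, Two, One, One, Two, One, Two, Two, One, Two],
       [One, Two, Two, One, One, Two, One, Two, Two, One, One, Two, Two, One, Two, One, One,
        Two, Two, One, One, Two, One, Two, Two, One, Two, One, One, Two, Two],
       [Two, One, One, Two, Two, One, One, Two, One, Two, Two, One, One, Two, Two, One, Two,
        One, One, Two, Two, One, One, Two, One, Two, Two, One, One, Two, Two],
       [One, Two, Two, One, Two, One, One, Two, Two, One, One, Two, One, Two, Two, One, One,
        Two, Two, One, Two, One, One, Two, Two, One, One, Two, One, Two, Two]]),
     (24,
      [[One, Two, Two, One, Two, One, One, Two, Two, One, One, Two, One, Two, Two, One, Two,
        One, One, Two, One, Two, Two, One, One, Two, Two, One, Two, One, One, Two, Two,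
        One, One, Two, One, Two, Two, One, Two, One, One, Two, Two, One, One],
       [Two, One, One, Two, Two, One, One, Two, One, Two, Two, One, Two, One, One, Two, One,
        Two, Two, One, One, Two, Two, One, Two, One, One, Two, Two, One, One, Two, One,
        Two, Two, One, Two, One, One, Two, One, Two, Two, One, One, Two, One],
       [Two, One, Two, Two, One, One, Two, Two, One, Two, One, One, Two, Two, One, One, Two,
        One, Two, Two, One, Two, One, One, Two, One, Two, Two, One, One, Two, Two, One,
        Two, One, One, Two, Two, One, One, Two, One, Two, Two, One, Two, One],
       [Two, One, Two, Two, One, One, Two, Two, One, Two, One, One, Two, Two, One, One, Two,
        One, Two, Two, One, Two, One, One, Two, One, Two, Two, One, One, Two, Two, One,
        Two, One, One, Two, Two, One, One, Two, One, Two, Two, One, One, Two],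
       [One, Two, Two, One, One, Two, One, Two, Two, One, Two, One, One, Two, One, Two, Two,
        One, One, Two, Two, One, Two, One, One, Two, Two, One, One, Two, One, Two, Two,
        One, Two, One, One, Two, One, Two, Two, One, One, Two, Two, One, Two],
       [Two, One, One, Two, Two, One, One, Two, One, Two, Two, One, Two, One, One, Two, One,
        Two, Two, One, One, Two, Two, One, Two, One, One, Two, Two, One, One, Two, One,
        Two, Two, One, Two, One, One, Two, One, Two, Two, One, One, Two, Two],
       [One, Two, Two, One, Two, One, One, Two, Two, One, One, Two, One, Two, Two, One, Two,
        One, One, Two, One, Two, Two, One, One, Two, Two, One, Two, One, One, Two, Two,
        One, One, Two, One, Two, Two, One, Two, One, One, Two, One, Two, Two],
       [Two, One, One, Two, One, Two, Two, One, One, Two, Two, One, Two, One, One, Two, Two,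
        One, One, Two, One, Two, Two, One, Two, One, One, Two, One, Two, Two, One, One,
        Two, Two, One, Two, One, One, Two, Two, One, One, Two, One, Two, Two]])]"

fun listed :: "(nat \<times> curl list list) list \<Rightarrow> nat \<Rightarrow> curl list \<Rightarrow> bool" where
  "listed [] p t = False"
| "listed ((q, us) # ps) p t = (if q = p then prefix_of_some us t else listed ps p t)"

lemma listedD: "listed ps p t \<Longrightarrow> \<exists>us u. (p, us) \<in> set ps \<and> u \<in> set us \<and> prefix u t"
  by (induction ps p t rule: listed.induct) (auto simp: prefix_of_some_iff split: if_splits)

text \<open>Here \<open>t\<close> is the curling list before the new letter and \<open>v\<close> is
  \<open>drop k t\<close>, so its head belongs to the position at distance \<open>Suc k\<close> from
  the new letter, and the periods from \<open>Suc k\<close> on are treated. A square at that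
  position which is short compared with the period would be copied to the new letter and yield a
  short square there. Otherwise the period must be refuted or fall under a window. At
  \<open>Start\<close> no further period fits.\<close>

fun long_ok :: "curl list \<Rightarrow> nat \<Rightarrow> curl list \<Rightarrow> bool" where
  "long_ok t k [] = True"
| "long_ok t k (Start # v) = True"
| "long_ok t k (One # v) =
    (if refuted k t v then long_ok t (Suc k) v
     else if listed windows (Suc k) t then long_ok t (Suc k) v else False)"
| "long_ok t k (Two # v) =
    (if square_bound (Two # v) \<le> Suc k then long_ok t (Suc k) v
     else if refuted k t v then long_ok t (Suc k) v
     else if listed windows (Suc k) t then long_ok t (Suc k) v else False)"

context
  fixes a :: 'a and r :: "'a list" and p :: nat
  assumes sq: "rep p p (a # r)" and short: "short_squares r"
begin

text \<open>Position \<open>0\<close> is left out because the curling number of the new letter is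
  what has to be determined; from position \<open>1\<close> on everything is inherited from
  \<open>r\<close>.\<close>

lemma marked_at:
  assumes "0 < j" "j \<le> length r"
  shows "drop j (marked (a # r)) = marked (drop j (a # r))"
    "marked (a # r) ! j = Two \<Longrightarrow>
      \<exists>q. rep q q (drop j (a # r)) \<and> q + q \<le> square_bound (drop j (marked (a # r)))"
    "rep q q (drop j (a # r)) \<Longrightarrow> marked (a # r) ! j = Two"
    "marked (a # r) ! j \<noteq> Start"
proof -
  obtain i where j: "j = Suc i" using assms(1) by (cases j) auto
  show "drop j (marked (a # r)) = marked (drop j (a # r))"
    using assms by (intro drop_marked) auto
  have nth: "marked (a # r) ! j = (if \<exists>p. rep p p (drop j (a # r)) then Two else One)" if "j < Suc (length r)"
    using that by (intro marked_nth) auto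
  have lt: "j < Suc (length r)" using assms by simp
  show "marked (a # r) ! j \<noteq> Start" using nth[OF lt] by (auto split: if_splits)
  show "rep q q (drop j (a # r)) \<Longrightarrow> marked (a # r) ! j = Two" using nth[OF lt] by auto
  assume "marked (a # r) ! j = Two"
  then obtain p' where "rep p' p' (drop i r)" using nth[OF lt] j by (auto split: if_splits)
  then show "\<exists>q. rep q q (drop j (a # r)) \<and> q + q \<le> square_bound (drop j (marked (a # r)))"
    using short_squaresD[OF short] unfolding j marked_Cons drop_Suc_Cons by blast
qed

lemma not_refuted:
  "0 < j \<Longrightarrow> j + k = p \<Longrightarrow> \<not> refuted k (drop j (marked (a # r))) (drop (j + p) (marked (a # r)))"
proof (induction k arbitrary: j)
  case (Suc k)
  define T where "T = marked (a # r)"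
  have len: "p + p \<le> Suc (length r)" using sq by (simp add: rep_def)
  have lt: "j < length T" "j + p < length T" and le: "j \<le> length r" "j + p \<le> length r"
    using len Suc.prems by (auto simp: T_def)
  have u: "drop j T = T ! j # drop (Suc j) T" and v: "drop (j + p) T = T ! (j + p) # drop (Suc j + p) T"
    using lt by (simp_all add: Cons_nth_drop_Suc)
  have IH: "\<not> refuted k (drop (Suc j) T) (drop (Suc j + p) T)"
    using Suc.IH[of "Suc j"] Suc.prems by (simp add: T_def)
  have notStart: "T ! j \<noteq> Start" "T ! (j + p) \<noteq> Start"
    using marked_at(4)[of j] marked_at(4)[of "j + p"] le Suc.prems by (auto simp: T_def)
  \<comment> \<open>With \<open>Suc k = p - j\<close> letters left, the bound gives
    \<open>j + q + q \<le> p\<close>, which is the condition of \<open>square_shift\<close>.\<close>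
  have A: "T ! j = Two" if c: "T ! (j + p) = Two" "square_bound (drop (j + p) T) \<le> Suc k"
  proof -
    obtain q where "rep q q (drop (j + p) (a # r))" "q + q \<le> square_bound (drop (j + p) T)"
      using marked_at(2)[OF trans_less_add1[OF Suc.prems(1)] le(2)] c(1) unfolding T_def by blast
    then have "rep q q (drop j (a # r))"
      using square_shift[OF sq, of j q] c(2) Suc.prems by simp
    then show ?thesis using marked_at(3)[of j] le Suc.prems by (auto simp: T_def)
  qed
  have B: "T ! (j + p) = Two" if c: "T ! j = Two" "square_bound (drop j T) \<le> Suc k"
  proof -
    obtain q where "rep q q (drop j (a # r))" "q + q \<le> square_bound (drop j T)"
      using marked_at(2)[OF Suc.prems(1) le(1)] c(1) unfolding T_def by blast
    then have "rep q q (drop (j + p) (a # r))"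
      using square_shift[OF sq, of j q] c(2) Suc.prems by simp
    then show ?thesis using marked_at(3)[of "j + p"] le Suc.prems by (auto simp: T_def)
  qed
  have "\<not> refuted (Suc k) (drop j T) (drop (j + p) T)"
    using IH notStart A B unfolding u v
    by (cases "T ! j"; cases "T ! (j + p)") auto
  then show ?case by (simp add: T_def)
qed simp

lemma long_ok_sound:
  assumes "k < p" "long_ok (marked r) k (drop k (marked r))"
  shows "(\<exists>q. rep q q (a # r) \<and> q \<le> 12) \<or> listed windows p (marked r)"
  using assms
proof (induction "p - 1 - k" arbitrary: k)
  case 0
  then have k: "p = Suc k" by simp
  have len: "p + p \<le> Suc (length r)" using sq by (simp add: rep_def)
  define T where "T = marked r"
  have T: "marked (a # r) ! Suc i = T ! i" "drop (Suc i) (marked (a # r)) = drop i T" for i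
    by (simp_all add: marked_Cons T_def)
  have u: "drop k T = T ! k # drop (Suc k) T"
    using len k by (simp add: T_def Cons_nth_drop_Suc)
  have le: "Suc k \<le> length r" using len k by simp
  have ns: "T ! k \<noteq> Start" using marked_at(4)[of "Suc k"] le T by simp
  have nr: "\<not> refuted k T (drop (Suc k) T)"
    using not_refuted[of 1 k] k by (simp add: T del: drop_Suc_Cons)
  \<comment> \<open>The square at distance \<open>p\<close> lies in the second half of the long
    square; \<open>square_shift\<close> with \<open>j = 0\<close> moves it to the new letter. Its
    period is at most 12 since \<open>square_bound\<close> never exceeds 24.\<close>
  have "T ! k = Two \<Longrightarrow> square_bound (drop k T) \<le> Suc k \<Longrightarrow> \<exists>q. rep q q (a # r) \<and> q \<le> 12"
  proof -
    assume two: "T ! k = Two" and b: "square_bound (drop k T) \<le> Suc k"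
    then obtain q where q: "rep q q (drop (Suc k) (a # r))" "q + q \<le> square_bound (drop k T)"
      using marked_at(2)[of "Suc k"] le unfolding T by auto
    then have "rep q q (drop (0 + p) (a # r))" by (simp add: k)
    then have "rep q q (drop 0 (a # r))"
      using square_shift[OF sq, of 0 q] q(2) b k by simp
    moreover have "q \<le> 12" using q(2) square_bound_le[of "drop k T"] by linarith
    ultimately show ?thesis by auto
  qed
  then show ?case
    using 0(3) ns nr unfolding T_def[symmetric] u k
    by (cases "T ! k") (auto split: if_splits)
next
  case (Suc n)
  define T where "T = marked r"
  have len: "p + p \<le> Suc (length r)" using sq by (simp add: rep_def)
  have u: "drop k T = T ! k # drop (Suc k) T"
    using len Suc.prems by (simp add: T_def Cons_nth_drop_Suc)
  have ns: "T ! k \<noteq> Start"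
    using marked_at(4)[of "Suc k"] len Suc.prems by (simp add: T_def marked_Cons)
  have "long_ok T (Suc k) (drop (Suc k) T)"
    using Suc.prems(2) ns unfolding T_def[symmetric] u
    by (cases "T ! k") (auto split: if_splits)
  moreover have "n = p - 1 - Suc k" "Suc k < p" using Suc.hyps(2) by auto
  ultimately show ?case using Suc.hyps(1)[of "Suc k"] by (simp add: T_def)
qed

end

text \<open>Found by computer; read backwards like everything else, so that words ending in \<open>Start\<close> are
  forbidden prefixes.\<close>

definition avoided :: "curl list list" where
  "avoided =
    [[Two, Two, One, Two, One, One, Two, Two, One, Two, One, One, Two, One, Two, Two, One, Two],
     [Two, Two, One, One, Two, Two, One, Two, One, One, Two, One, Two, Two, One, Two],
     [Two, Two, One, Two, One, One, Start],
     [Two, Two, One, One, Start],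
     [Two, Two, One, Two, One, One, Two, One, Start],
     [Two, Two, One, Two, One, Start],
     [Two, Two, One, Start],
     [Two, Start]]"

section \<open>Exhaustive search over curling words\<close>

definition admissible :: "curl list \<Rightarrow> bool" where
  "admissible T \<longleftrightarrow> (\<forall>k. \<not> repetitive (drop k T) \<and> \<not> prefix_of_some avoided (drop k T))"

text \<open>Period \<open>p\<close> is treated at \<open>k = p - 1\<close>, so starting at 12 covers
  exactly the periods above 12.\<close>

definition long_squares_ok :: "curl list \<Rightarrow> bool" where
  "long_squares_ok t = long_ok t 12 (drop 12 t)"

text \<open>\<open>t\<close> is a complete curling list, ending in \<open>Start\<close> and extended
  at its head. \<open>long_squares_ok\<close> is demanded before \<open>avoided\<close> is
  consulted: it will be used while the next curling number is still open, when a \<open>Two\<close>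
  may be excluded by repetitions but not yet by \<open>avoided\<close>.\<close>

fun explore :: "nat \<Rightarrow> curl list \<Rightarrow> bool" where
  "explore 0 t = False"
| "explore (Suc n) t =
    ((if repetitive (Two # t) then True
       else if long_squares_ok t
         then if prefix_of_some avoided (Two # t) then True else explore n (Two # t)
         else False) \<and>
    (if repetitive (One # t) then True
     else if prefix_of_some avoided (One # t) then True else explore n (One # t)))"

text \<open>The induction follows the search, so it moves the entry of \<open>u\<close> adjacent to
  \<open>t\<close>, which is the earliest in the word, over to \<open>t\<close>.\<close>

lemma explore_sound:
  assumes "explore n t" "admissible (u @ t)" "Start \<notin> set u"
  shows "length u < n \<and> (repetitive (Two # u @ t) \<or> long_squares_ok (u @ t))"
  using assms
proof (induction n arbitrary: t u)
  case (Suc n)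
  show ?case
  proof (cases u rule: rev_cases)
    case Nil
    then show ?thesis using Suc.prems(1) by (auto split: if_splits)
  next
    case (snoc v c)
    have "\<not> repetitive (drop (length v) (u @ t))" "\<not> prefix_of_some avoided (drop (length v) (u @ t))"
      using Suc.prems(2) unfolding admissible_def by auto
    then have "\<not> repetitive (c # t)" "\<not> prefix_of_some avoided (c # t)" by (simp_all add: snoc)
    moreover have "c = One \<or> c = Two" using Suc.prems(3) snoc by (cases c) auto
    ultimately have "explore n (c # t)" using Suc.prems(1) by (auto split: if_splits)
    moreover have "admissible (v @ c # t)" "Start \<notin> set v" using Suc.prems snoc by auto
    ultimately show ?thesis using Suc.IH[of "c # t" v] snoc by simp
  qed
qed simp

section \<open>States\<close>

text \<open>A state is a pair of known beginnings, of the word up to renaming of the letters and of its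
  curling numbers.\<close>

datatype letter = La | Lb | Lc | Lstart

fun has_start :: "letter list \<Rightarrow> bool" where
  "has_start [] = False"
| "has_start (a # s) = (if a = Lstart then True else has_start s)"

text \<open>If the lag runs past the known letters, no mismatch is visible. The square is then
  excluded only when the start of the word is among the known letters, which makes the word too
  short.\<close>

fun apart :: "nat \<Rightarrow> letter list \<Rightarrow> letter list \<Rightarrow> bool" where
  "apart m s [] = has_start s"
| "apart m s (b # v) = disagree m s (b # v)"

fun all_apart :: "(nat \<times> nat) list \<Rightarrow> letter list \<Rightarrow> letter list \<Rightarrow> bool" where
  "all_apart [] s v = True"
| "all_apart ((d, m) # ps) s v =
    (if apart m s (drop d v) then all_apart ps s (drop d v) else False)"

lemma all_apartD:
  "all_apart ps s (drop k s) \<Longrightarrow> (p, m) \<in> set (lags k ps) \<Longrightarrow> apart m s (drop p s)"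
  by (induction ps arbitrary: k) (auto simp: add.commute split: if_splits)

definition short_lags :: "(nat \<times> nat) list" where
  "short_lags = [(1, 1), (1, 2), (1, 3), (1, 4), (1, 5), (1, 6), (1, 7), (1, 8), (1, 9), (1, 10), (1, 11),
    (1, 12)]"

lemma short_lags: "1 \<le> p \<Longrightarrow> p \<le> 12 \<Longrightarrow> (p, p) \<in> set (lags 0 short_lags)"
  by (simp add: short_lags_def) presburger

text \<open>The mere failure of \<open>prefix\<close> would not do: a known beginning that is too
  short could still be continued to \<open>u\<close>. \<open>parallel\<close> means that a mismatch
  is already visible.\<close>

fun all_parallel :: "'a list list \<Rightarrow> 'a list \<Rightarrow> bool" where
  "all_parallel [] t = True"
| "all_parallel (u # us) t = (if parallel u t then all_parallel us t else False)"

lemma all_parallel_iff: "all_parallel us t \<longleftrightarrow> (\<forall>u\<in>set us. parallel u t)"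
  by (induction us) auto

text \<open>For each period there are two ways out: the known curling numbers contradict all its
  windows, or two different letters are visible at that distance.\<close>

fun windows_ok :: "(nat \<times> curl list list) list \<Rightarrow> letter list \<Rightarrow> curl list \<Rightarrow> bool" where
  "windows_ok [] s t = True"
| "windows_ok ((p, us) # ps) s t =
    (if all_parallel us t then windows_ok ps s t
     else if disagree p s (drop p s) then windows_ok ps s t else False)"

lemma windows_okD:
  "windows_ok ps s t \<Longrightarrow> (p, us) \<in> set ps \<Longrightarrow> u \<in> set us \<Longrightarrow> parallel u t \<or> disagree p s (drop p s)"
  by (induction ps) (auto simp: all_parallel_iff split: if_splits)

section \<open>Renaming the letters of a state\<close>

fun next_letter :: "letter \<Rightarrow> letter" where
  "next_letter La = Lb" | "next_letter Lb = Lc" | "next_letter Lc = La" | "next_letter Lstart = Lstart"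

text \<open>If the known letters show nothing besides \<open>a\<close>, some other letter is chosen,
  so that \<open>rename\<close> is a permutation in every case.\<close>

fun second_letter :: "letter \<Rightarrow> letter list \<Rightarrow> letter" where
  "second_letter a [] = next_letter a"
| "second_letter a (b # s) =
    (if b = a then second_letter a s else if b = Lstart then next_letter a else b)"

definition rename :: "letter \<Rightarrow> letter \<Rightarrow> letter \<Rightarrow> letter" where
  "rename a b c = (if c = Lstart then Lstart else if c = a then La else if c = b then Lb else Lc)"

definition canonical :: "letter list \<Rightarrow> letter list" where
  "canonical s = map (rename (hd s) (second_letter (hd s) s)) s"

lemma second_letter:
  "a \<noteq> Lstart \<Longrightarrow> second_letter a s \<noteq> a \<and> second_letter a s \<noteq> Lstart"
  by (induction s) (cases a; auto)+

lemma bij_rename: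
  assumes "a \<noteq> Lstart" "b \<noteq> Lstart" "b \<noteq> a"
  shows "bij (rename a b)"
proof (rule bijI)
  show "inj (rename a b)"
  proof (rule injI)
    fix x y assume "rename a b x = rename a b y"
    then show "x = y"
      using assms by (cases x; cases y; cases a; cases b) (auto simp: rename_def)
  qed
  show "surj (rename a b)"
  proof -
    have "\<exists>x. y = rename a b x" for y
    proof (cases y)
      case La then show ?thesis using assms by (intro exI[of _ a]) (auto simp: rename_def)
    next
      case Lb then show ?thesis using assms by (intro exI[of _ b]) (auto simp: rename_def)
    next
      case Lc
      obtain c where "c \<noteq> a" "c \<noteq> b" "c \<noteq> Lstart"
        using assms by (cases a; cases b) auto
      then show ?thesis using Lc by (intro exI[of _ c]) (auto simp: rename_def)
    next
      case Lstart then show ?thesis by (intro exI[of _ Lstart]) (auto simp: rename_def)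
    qed
    then show ?thesis by (simp add: surj_def)
  qed
qed

text \<open>The marker is the number \<open>3\<close> on the side of the word.\<close>

definition naming :: "(letter \<Rightarrow> nat) \<Rightarrow> bool" where
  "naming f \<longleftrightarrow> inj f \<and> f Lstart = 3 \<and> range f = {0, 1, 2, 3}"

text \<open>Renaming the known letters is compensated by composing the naming with the inverse
  permutation, so one state stands for all its renamings.\<close>

lemma canonical_naming:
  assumes "naming f" "s \<noteq> []" "hd s \<noteq> Lstart"
  shows "\<exists>g. naming g \<and> map g (canonical s) = map f s"
proof -
  define h where "h = rename (hd s) (second_letter (hd s) s)"
  have h: "bij h" unfolding h_def
    using second_letter[OF assms(3)] assms(3) by (intro bij_rename) auto
  have hS: "h Lstart = Lstart" by (simp add: h_def rename_def)
  have inv: "inv h (h x) = x" for x using h by (simp add: bij_is_inj)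
  have "naming (f \<circ> inv h)"
    unfolding naming_def
  proof (intro conjI)
    show "inj (f \<circ> inv h)"
      using assms(1) h by (intro inj_compose) (auto simp: naming_def bij_imp_bij_inv bij_is_inj)
    show "(f \<circ> inv h) Lstart = 3" using inv[of Lstart] hS assms(1) by (simp add: naming_def)
    have "range (f \<circ> inv h) = range f"
      using h by (metis bij_imp_bij_inv bij_is_surj fun.set_map)
    then show "range (f \<circ> inv h) = {0, 1, 2, 3}" using assms(1) by (simp add: naming_def)
  qed
  moreover have "map (f \<circ> inv h) (canonical s) = map f s"
    unfolding canonical_def h_def[symmetric] by (simp add: inv)
  ultimately show ?thesis by blast
qed

lemma agree_map: "inj f \<Longrightarrow> agree n (map f u) (map f v) = agree n u v"
  by (induction n u v rule: agree.induct) (auto simp: inj_eq)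

lemma disagree_map: "inj f \<Longrightarrow> disagree n (map f u) (map f v) = disagree n u v"
  by (induction n u v rule: disagree.induct) (auto simp: inj_eq)

text \<open>A state is stored as the binary expansion of a number, least significant bit first: two bits
  for each letter, \<open>11\<close> after the last one, then one bit each for the end markers of the
  word and of the curling numbers, and one bit for each curling number.\<close>

fun letters_num :: "num \<Rightarrow> letter list" where
  "letters_num (num.Bit0 (num.Bit0 n)) = La # letters_num n"
| "letters_num (num.Bit1 (num.Bit0 n)) = Lb # letters_num n"
| "letters_num (num.Bit0 (num.Bit1 n)) = Lc # letters_num n"
| "letters_num (num.Bit1 (num.Bit1 (num.Bit0 n))) = []"
| "letters_num (num.Bit1 (num.Bit1 (num.Bit1 n))) = [Lstart]"
| "letters_num _ = []"

text \<open>The leading bit of the number, \<open>num.One\<close>, stands for no curling number and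
  ends the list; \<open>e\<close> supplies the end marker, if any.\<close>

fun curls_bits :: "curl list \<Rightarrow> num \<Rightarrow> curl list" where
  "curls_bits e num.One = e"
| "curls_bits e (num.Bit0 n) = One # curls_bits e n"
| "curls_bits e (num.Bit1 n) = Two # curls_bits e n"

fun curls_num :: "num \<Rightarrow> curl list" where
  "curls_num (num.Bit0 (num.Bit0 n)) = curls_num n"
| "curls_num (num.Bit1 (num.Bit0 n)) = curls_num n"
| "curls_num (num.Bit0 (num.Bit1 n)) = curls_num n"
| "curls_num (num.Bit1 (num.Bit1 (num.Bit0 (num.Bit0 n)))) = curls_bits [] n"
| "curls_num (num.Bit1 (num.Bit1 (num.Bit1 (num.Bit0 n)))) = curls_bits [] n"
| "curls_num (num.Bit1 (num.Bit1 (num.Bit0 (num.Bit1 n)))) = curls_bits [Start] n"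
| "curls_num (num.Bit1 (num.Bit1 (num.Bit1 (num.Bit1 n)))) = curls_bits [Start] n"
| "curls_num _ = []"

definition state_letters :: "nat \<Rightarrow> letter list" where
  "state_letters n = letters_num (num_of_nat n)"

definition state_curls :: "nat \<Rightarrow> curl list" where
  "state_curls n = curls_num (num_of_nat n)"

text \<open>The first code, 31, is the state of the empty word. The other codes are justified solely
  by the closure check, which is carried out for each of these chunks.\<close>

definition states1 :: "nat list" where
  "states1 = [
31, 188, 1520, 1268, 11220, 10192, 85764, 89936, 85924, 77588, 77716, 687120, 687428, 687760,
621648, 597252, 597412, 597156, 597508, 622160, 5502228, 5404052, 5502224, 5405284, 5402772,
5405204, 4813124, 4813840, 4814480, 4813456, 4814864, 4815172, 43772324, 43374160, 43761940,
43772308, 43379088, 43369040, 43378768, 38651152, 38659348, 38659344, 349112356, 349151876,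
350201488, 350159952, 350179588, 349133220, 349112484, 349151748, 350201424, 308756756, 308767124,
308750756, 308750740, 308773140, 2793152656, 2793310736, 2793314884, 2795249812, 2795407892,
2795324436, 2795333268, 373572, 2795411812, 2793236112, 2793153168, 2793310224, 2793314628,
2795250324, 2795407380, 2472300804, 2472346704, 2468239780, 2468127236, 2468219044, 2472388176,
2472322704, 2468153380, 2468192900, 2472322640, 2468153508, 2468192772, 2468108708, 2472412240,
2472431876, 22329758868, 22329792020, 22329442708, 22330108180, 22329459300, 209712, 22354924708,
22354957828, 22354608548, 22355273988, 22354609412, 22355273124, 22354627076, 22355255460]"

definition states2 :: "nat list" where
  "states2 = [
22354627108, 22355255428, 22329461268, 22330089620, 22329757844, 22329793044, 22329443732, 53687572,
22329461348, 22354923684, 22354958852, 22354609572, 22355272964, 11181398372, 11181048852,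
11181581972, 19754739344, 19754289168, 19754555716, 19754656400, 11181131796, 11181499028,
11181236372, 11181394452, 19754393744, 19754293828, 19754551824, 11181236884, 11181393940,
19754394256, 19754293572, 19754551312, 19754215056, 11181057684, 11181573140, 11181136228, 102596,
178640933456, 178642330788, 6412, 178641066064, 178639668816, 178642264324, 178642330704,
178639735184, 178875814544, 178874616132, 178875947024, 178874549904, 178877145412, 178877211664,
178874553360, 178875810116, 178877208208, 178874624016, 178875951428, 178877137552, 178874624144,
178877137424, 178877208132, 178639743056, 178642256464, 178640929360, 178641070160, 178639672912,
178639743376, 178875810448, 178874624324, 178875951120, 178874554000, 178877137220, 178877207568,
89419030660, 89420499492, 89419433220, 89420096932, 89419030692, 89420499460, 158004289684,
158005758484, 158004692372, 158005758564, 158003957908, 158006090260, 89419433380, 89420096772,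
89418698916, 89420831236, 89418733060, 89420797092, 89419049220, 89420480932, 158003992084,
158006056084, 158004707940, 158004308244, 158005739924, 89418734084, 89420796068, 89419048196]"

definition states3 :: "nat list" where
  "states3 = [
89420481956, 158003993108, 158006055060, 158004709988, 158005740948, 158004709908, 158005338260,
89419450884, 89420079268, 89419048356, 89420481796, 89419450916, 89420079236, 1429144507024,
1429144506692, 22129416724, 22140063892, 357770470672, 22134475364, 1431080281364, 22139798932,
22134475284, 22135005332, 22129416804, 1431090398480, 22129681812, 22135022996, 1431085057296,
22140050020, 22129713300, 22139767316, 22134457748, 1431085622548, 22139767396, 1431085622544,
1430878703764, 22140049940, 22134457492, 22135023124, 22129430932, 1430889322772, 22129713764,
1431090649360, 22129433108, 22140047508, 357770503440, 22134458980, 357770503444, 22139766164,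
22134458900, 22135021716, 22129433188, 1431090365712, 22129714580, 715500585488, 715437741636,
715506460816, 715432149316, 715435086864, 715504850576, 715500585616, 715506460688, 715507788100,
1264182657616, 1264188532816, 1264184268368, 1264188533136, 1264181330512, 1264189859920,
715502196368, 715500585284, 715437741072, 715499258512, 715506460996, 715507787792, 715432286224,
715435149636, 715507651216, 715500659728, 715437678916, 715506386576, 1264181467216, 1264182731940,
1264189723216, 1264184330640, 1264182731856, 1264186859780, 1264188458576, 715432290320,
715435157828, 715507647120, 715500655632, 715437670724, 715506390672, 1264181471312, 1264189719120,
1264184338832, 1264188462672, 1264184338512, 1264186851920]"

definition states4 :: "nat list" where
  "states4 = [
715432290628, 715502266384, 715504779920, 715500656272, 715506390032, 715507646788, 715502266512,
715500656196, 715504779792, 11432064225428, 11431836260884, 11432064227940, 177638238288,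
177412391504, 2862113696148, 2862115815700, 177390037392, 11448457963940, 177411331664,
177390037072, 177392157264, 177638238608, 2862110239124, 11448480317716, 177639298640, 177392227920,
11448480262548, 177412336016, 177639424592, 177411205200, 177389966928, 11448479132068,
177411205520, 11448438915348, 11448479132052, 11447632478800, 177412335696, 177389965904,
177392228432, 177638295120, 11447405388036, 177412334672, 177639426448, 11448438917524,
11448479129876, 177638303824, 44352225872, 2862113630612, 2862115881236, 177389971856,
2862113630628, 177411200592, 177389971536, 177392222800, 177638304144, 2862110304660,
11448480252180, 177639429712, 88533651860, 5723272927508, 88282276452, 88521901204, 88287585812,
88275835492, 88287585684, 88527211028, 88282275988, 5723530743956, 88275835412, 88521901460,
88527211108, 88521902612, 88287584404, 88533654116, 88282277268, 88533654036, 88275832980,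
88521902692, 88527209876, 88275584404, 88287038052, 88527507604, 88281979412, 88533902740,
88281979492, 88522449044, 88287037972, 10114054918800, 10114054918468, 88275551636, 88287021668,
88527491220, 88281995796, 88533935508, 88281995876, 88522465428, 88287021588, 88275552868,
88555455892, 88527493652]"

definition states5 :: "nat list" where
  "states5 = [
5723279085716, 88533934228, 88275552788, 88522466708, 88527493732, 88522466836, 88555455636,
88533934692, 5723524585748, 88281993620, 91454626218576, 12284497007780, 22862875727364,
12284416065956, 5715849144400, 22862889560324, 91454626228624, 12284497003044, 22862875732100,
5724172296708, 22896712419492, 22896708180388, 91586692227716, 22896712419364, 5724169347588,
22896698591396, 91586696468900, 91586696972452, 22896707674628, 91586692450340, 22896712196740,
91586772883876, 91586692450468, 22896712196612, 5723909673620, 5723906216260, 91586772879524,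
22896698876420, 91586692454820, 5724172558852, 22896712157348, 22896707656100, 5724172558980,
22896712157220, 22896689848836, 22896698853540, 91586696993188, 710616893008, 709611391376,
709611389520, 45790593630800, 710616902032, 709611394640, 710616901712, 709610203216, 710617896528,
709610203536, 80910542213268, 20227392412180, 80910542215780, 709610268752, 710618027600,
709610269072, 45789586997840, 710618022480, 710618024336, 709610260048, 731629766202004,
3945168132116, 24572385710736, 182904169236804, 45726073116688, 24572330378896, 11431643055764,
3945156355092, 182904279900484, 6143105868816, 731629766183060, 3945168151060, 24572385691792,
182904169276996, 6143117664784, 11448554522640, 11448559507780, 45794243912336, 183177010308752,
732707479259664, 11448559508036, 45794243911824, 11448554527044, 11448559503376, 45794255708816,
45794250548880, 45794252563088, 183177008285712, 45794243025220, 45794234474640, 183177008290372,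
45794243021328, 183176936908432]"

definition states6 :: "nat list" where
  "states6 = [
45794234475152, 183177008290116, 45794243020816, 45791031335428, 45791031368292, 183176936891024,
45794252593476, 11448561010704, 45794234492560, 11448555571216, 11448558459204, 45794242863760,
183177008211600, 45794234632720, 11448558459460, 45794242863248, 11448555575620, 183176936982544,
45794256757392, 45794252646032, 40454524900868, 365818747699792, 40454538733828, 40454524905604,
365818747709840, 5853005406018052, 31560361583876, 468395132324, 2929204, 1463238586017040,
365809748944148, 91452961540612, 3492032897188, 1873547634084, 7890098619652, 1463239028671760,
5853005406103044, 1873521231012, 31560361744644, 468394971556, 1463238586177808, 91588254516628,
91588274457188, 366353062367380, 91588273740308, 1465411771703444, 91588274457108, 5861648175360276,
91588254515604, 91588274455140, 366353062368404, 91588273739284, 91588254534244, 91588274439572,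
366353062402580, 91588273705108, 366352947355796, 91588254534164, 366352942829716, 91588259060244,
1465411775251860, 366353070459492, 366352942863892, 366353087534228, 1465411775267428,
366353070440852, 91588265666836, 1465411775269396, 91588270891156, 366352942864916, 91588259025044,
1465411775269476, 366353070441876, 91582873233424, 464678912356, 91582890322244, 91582873364880,
464678847012, 56397444556932, 1465411775339028, 91588270821524, 366352942795364, 91588265526676,
366352942795284, 91588259094676, 91588258710932, 91588270262884, 366353070755988, 91588265351700,
1465411775897748, 91588270262804, 366352943180052, 91588258709908, 91588270260836, 366353070757012,
91588265350676, 91588258728548, 1465412345677204, 366353070791188, 91588265316500]"

definition states7 :: "nat list" where
  "states7 = [
366352943161492, 91588258728468, 80909908334608, 323639510108484, 2926520189473428, 323639620772164,
323639510148676, 2926520189454484, 46824197592213520, 63124025977156, 15001793369104,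
15781010440516, 937613203088, 2926465174022548, 11705862054052116, 2926465174022564, 3945252546884,
182906771548176, 6984917418640, 15001793369744, 234396193808, 15781023334724, 2926465362454932,
11705862939361556, 46824197592553488, 63124025674052, 937616020112, 15001794012176, 15781010743620,
937612560016, 2926465173719444, 11705862054355220, 183177360512592, 732709513210256,
2930837910995536, 732709433447940, 183177370298448, 11723349732917840, 183177373165648,
2930837639700740, 183177354781776, 183177360508496, 732709513202064, 2930837910999632,
2930837451023524, 183177370294352, 183177360583056, 183177373095504, 2930837911136336,
183177370157648, 183177354707536, 183177360582736, 2930837432844880, 183177378687056,
732709362144848, 183177377360272, 2930837432981584, 2930837501355172, 183177378550352,
183177356380560, 183177377285712, 732709478048848, 732709498953988, 2930837653956688,
183177358901840, 2930837432985680, 183177378546256, 183177356388752, 183177377289808,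
732662165013908, 3731321390480, 732662233369188, 732662164752532, 183165567672852, 3731321129104,
112795748771396, 42427005575696, 183177356666960, 183177358623312, 2930837432707472,
732709477488208, 2930837432707152, 183177378824784, 732709476788304, 732709496432720,
2930837656477956, 2930837434246224, 2930837434246308, 732709476784208, 11723352028812880,
732709476647504, 2930837434171984, 183177377359952, 647282578171156, 2589129902925072,
23412030007941636, 2589130345579792, 2589129903085840, 23412030008026628, 374594218835092756]"

definition states8 :: "nat list" where
  "states8 = [
88283153812, 126251445822736, 1412661054052, 5648227280276, 353133681252, 31562877240592,
88273428628, 353146309140, 733380, 23411742521730640, 45836, 1463233923928324, 93646975518770256,
23411742521730704, 31562867516688, 88283155044, 365814402360596, 353146307988, 88286059028,
55878470881428, 5648227278996, 88283154964, 88273429908, 353030527588, 31562861708560,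
23411743275460176, 23411742854369540, 93646979060008016, 374594218833880340, 88284366228,
126251444610320, 1412659694180, 88288628884, 353131108884, 5648226067860, 353131108964,
31562878453008, 88274788500, 353144949268, 23411742520518224, 1463233926500612, 93646975519982672,
5861689056843792, 14439555841560900, 14439555841561232, 14439556042887824, 3609889421562180,
5861293634961924, 49671525460132, 29838296039956, 1864915576980, 198686076912164, 5861294181804164,
5861293636019716, 49671524402340, 366330882988292, 198686001074596, 29838297097748, 1864914519188,
225592320891152, 1864825840228, 339415061141780, 1864829768084, 14439555774452036,
14439555774452368, 5178256397773220, 20713026949054740, 5178256397773204, 187296823904331792,
20713027834364180, 5178256586205588, 20713026949357844, 5178256397470100, 187296823904671760,
2996751830830295460, 709614900816, 63125517140244, 1010008345291156, 709552777616, 177407694416,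
177396083088, 252502084239636, 63125510515092, 177402708560, 709552777296, 2926464920356884,
11705859891798676, 11705859584465252, 731616222200852, 11705859841287828, 2926464920357396,
11705859891798164, 63125522120980, 252502072633748, 709614905744, 2926514351384996, 709552772688,
709626521680, 6985019900496, 177407689296]"

definition states9 :: "nat list" where
  "states9 = [
709614905424, 177402713680, 2838051252624, 252502084250004, 63125510504724, 11705859584460820,
2926464959259284, 11705859378157924, 11705859428673172, 731616232162324, 2996751830824855972,
709619750480, 63125522579732, 1010008339851668, 709547338128, 177396400720, 709491976272,
177402844752, 709491976592, 63125510832404, 252501949704596, 177408148048, 709547337808,
2926464925796372, 731616210133652, 11705859579615588, 731616232490004, 2926464836331156,
46893499322631572, 115516399469763172, 28879098215012884, 115516399469760660, 28879098442977428,
115516399241796116, 28879098442979940, 46890404576299024, 183165647870276, 99343910937232,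
238925073680464, 14932905402960, 1589502235969680, 46890406428845636, 99343910937104,
46890404580530192, 11722601078491460, 397375618835472, 732662592053572, 14932869748816,
14932901171792, 45518887618964, 451184394117396, 3733150796176, 14933208753232, 2715333782282500,
3733166507600, 115516399201327716, 28879098483448340, 115516399201325204, 41426106671474320,
165704432117744720, 2589131683287300, 41426106671474256, 1498376947318957332, 165704435658982480,
41426107004113156, 41426107425203792, 165704432118957136, 2589131685859588, 41426106670261840,
1498376947317744916, 23974005554180065316, 1463256946680452, 12426188727952, 505007490860112,
126251860381956, 126250788084132, 8080049565927588, 126250807304708, 12426188727888,
2020030026155088, 126250786642340, 12426168783108, 505003195893924, 505007464359504,
126250808025604, 23411706898834692, 1463231694521764, 93646827578265764, 5852926795160068,
93646827376222340, 1463231714462244, 1463231693088164, 5852926708827396, 23411707147329700,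
93646829430802948, 23411706898835716, 1463231694520740, 93646827578266788, 5852926795159044,
31562961408260]"

definition states10 :: "nat list" where
  "states10 = [
505007510783056, 505003102984612, 2020012846326276, 126250807265444, 12426168804944,
23412111076336260, 1463256946640932, 12426168805008, 55880948798100, 2020030026196560,
126250786621604, 126250788102660, 505003195914660, 12426255074384, 12426188706052,
93646827376239876, 5852926728750500, 23411707349408260, 1463231713710244, 93646828201451652,
1463231694539300, 93646828201451684, 5852926708845060, 5852926821688740, 1463231714444548,
1463256947951652, 2068497629684277892, 12426166970000, 505007512618064, 126251840983300,
126250807482788, 126250808576164, 505003128234500, 12426166969936, 505007465628752, 505003196438948,
12426188181764, 126250788456612, 2020029488014928, 31562695746052, 23411706879436036,
1463231713920420, 1463231715020964, 5852926754003460, 93646827397980292, 1463231692704292,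
5852926822213028, 1463231713920260, 23411707169087652, 5852926707010052, 3071138621604,
198785273304656, 57758185750675972, 3609886551582852, 50889034100271504, 14439546006087940,
3609886551578116, 12722258195923536, 50889024436585040, 12722257122191760, 375123461632255252,
12716005070030228, 1465326030120208, 198687570954852, 794750150512788, 198687573842452,
198687561180692, 12716005070029972, 794750153400932, 375123466006993168, 794750150513044,
49671888345364, 375123461615527188, 5861304095089936, 12716003793586788, 3179000650409364,
5861304122770704, 91041302718032, 225592409166084, 902369645200464, 53261124, 203556119464002128,
20713050556604564, 5178262586558996, 1294565638751252, 20713050506094228, 20713050249271652,
20713050556605076, 5178262586558484, 11987006786753538468, 20713050093479572, 1294565648712724,
20713050042964324, 5178262625460884, 20713050249267220, 1294565649040404, 5178262502532756,
20713050244421988, 1294565626684052, 5178262591997972]"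

definition states11 :: "nat list" where
  "states11 = [
11987006786748098980, 191792083875994542224, 11706058893855248, 63125604964932, 1481268,
252502427657872, 64640617440092816, 63125602076688, 63125604964676, 252502421890704,
4040038982099600, 63125602081092, 252502440314896, 187293677036011844, 2926463697916944,
2926463703651984, 749174704099836560, 11705854882899984, 46823419026745668, 749174703291662864,
749174706592650820, 11705854885767312, 2926463697917584, 46823419132789060, 2926463703651344,
187293677036012176, 749174710701812036, 11705854885767184, 187293677036020036, 2926463697921040,
2926463703647888, 749174704099840656, 11705854882895888, 46823419026737476, 4040038610462352,
16160156179400720, 252502427736388, 252502437274256, 187296942019480080, 252502427736644,
11706058893697168, 447046857792004, 252502421807760, 1010009619470660, 252502427731984,
4040038982182544, 24482235412, 731615926522896, 749174706592579908, 46823419026675344,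
187293677844326416, 46823418947053892, 2926463713297040, 187293677036082756, 749174706592580112,
2926463703722128, 749174706592580240, 46823419132930372, 46823418947053584, 46823419398428304,
731615920931140, 731615923868688, 11706058898940048, 16548017827891022352, 1010009694706244,
252502438143632, 252502442517136, 63125605222416, 4040038523509060, 4040038984279696,
252502429147792, 63125605226820, 63125601814544, 187293677123043652, 46823419400524816,
2926463714137744, 2926463718539920, 46823419127687184, 46823418939713860, 187293677123043856,
749174706515056196, 2926463696382096, 46823419400525456, 11705854888001860, 2926463714137104,
187293677123043984, 46823419127687492, 46823418939713552, 24572455920272, 1590281308840596,
397570327775252, 462065698909739332, 1804944137586704, 28879105655678532, 407111981016942740,
115516424241389892, 1804944140687376, 28879105655638340, 101777997120557716, 407112006786765460]"

definition states12 :: "nat list" where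
  "states12 = [
101778005710473364, 3000987492206389668, 94741808, 11722607272427796, 11722607373724052,
3000987457208486292, 2930651814306068, 24253903108, 3000987492138690980, 11722607340126484,
46890429543688596, 11722607395488020, 46890429488327060, 45520451635220, 45520417530516,
451184754727268, 45520439886868, 1804739033720468, 1628448062631465620, 165704387256456356,
10356524275045892, 2589131064492452, 41426096818383108, 10356524188714244, 2589131063059876,
165704389108992516, 41426097066877092, 2589131084433956, 165704387054411908, 165704387256455332,
10356524275046916, 2589131064493476, 41426096818382084, 8273988861213083684, 10356524188731908,
165704387879641252, 2589131084416260, 10356524301575588, 2589131064511012, 165704387879641220,
41426097268955652, 2589131083681956, 10356524208637348, 165704387054429444, 2589131083891972,
10356524302099876, 10356524186896900, 41426097088635044, 2589131062676004, 165704387076169860,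
2589131084992676, 10356524233890308, 2589131083892132, 41426096798983428, 8273989524247388804,
1534336481960944538772, 30015614195220, 30015607554452, 93648467264170260, 30015619105380, 740620,
30015619107348, 120062461223060, 30735973874995348, 30015614196244, 30015607555476, 30015619107428,
30015607573012, 120062472757396, 1920999631460884, 30015614161044, 30015607573092, 120062359913876,
902482177950992, 353144186260, 353132716180, 90385785704596, 93646835176482068, 225619615458576,
5993396327397349652, 3609922506217744, 1412658930276, 1412009362580, 353132717588, 353144184980,
225620039632144, 1412316944996, 353132717460, 5650375924244, 1498349085890203796, 3609938942862608,
353031488916, 93646835165013268, 902482177983760, 353144153492, 353132699796, 90385785720980,
93646835176449300, 374587338640598288, 30015619735700]"

definition states13 :: "nat list" where
  "states13 = [
1920998887688724, 7683991043851668, 120062460594788, 30015607869588, 120062472460820,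
7683991043850644, 93648466945403156, 120062460592740, 93648466603218068, 120062472459796, 852677444,
3410709520, 1859335324004, 30015607904788, 120062472425620, 480249630460516, 120062460577172,
1920999631129108, 30015614492820, 3609922505934096, 1412658649700, 5649632135700, 22594021623188,
374587338321863956, 353132153444, 225619296691472, 353143904788, 902482178234640,
5993396314193680660, 353143902612, 353132151956, 5993396347066405012, 225620040197392,
1412316662372, 374587339065369876, 353132152212, 5650375641620, 93648466611606676, 120062464071188,
30015620137364, 7868415721956075796, 480249981731428, 30015606524436, 120062339588244,
30015616258196, 120062464072212, 30015620138388, 1920998908660324, 30015620155924, 1920997477982356,
30015616293396, 120062464037012, 30015620156004, 30015606506900, 902482526078224, 353135516260,
5648222299540, 88274438676, 353011081364, 88284221588, 353135516180, 88288134548,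
374587338292503828, 5649653107300, 225619267331344, 1498349079114438932, 353135514004,
3609922195839248, 1412310803044, 88274437268, 353011082772, 88288135700, 5648222298260,
56405429126416, 88284224100, 353011082644, 88284224020, 1498349086200582292, 88288135780,
225620019225872, 88274437524, 374587339044398356, 795140420704772, 7493717069988, 1873428432292,
795140409091332, 3696526448767624464, 14439556461978900, 231032900943255824, 3256895098152642052,
924131610247726352, 14439556436993300, 231032900943095056, 814223776737139204, 3256895046612949508,
814223793917093380, 24007898832832628772, 24007898929966981764, 12426169329296, 23445218112177232]"

definition states14 :: "nat list" where
  "states14 = [
49704986890500, 5861303458748836, 5861303457482916, 93780855254262276, 12426169329232,
12724394820511312, 1465325855334916, 5861303458744484, 5861303457487268, 12426215526660,
12426169320528, 24007898833371072548, 24007898929428537988, 49705008890960, 5861304491462916,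
5861303457962404, 5861303459055780, 23445213730152964, 49705230337104, 23445213798357412,
5861303438936228, 198820546848336, 1465325858365956, 364162628871428, 91040665585060,
91040666685604, 364162560662020, 3609477855453316, 91040644368932, 364162628871588, 91040665584900,
3609477855453348, 364162513668612, 13027580675872004612, 1325635318964310672, 82852207455766852,
20713051990153232, 5178262980462224, 331408830752137540, 5178262974735376, 5178262980465680,
82852207561818436, 5178262974731920, 20713051993024528, 1325635325566282052, 331408830752129680,
20713051993024656, 1325635318156132880, 1325635321457120836, 1325635318964306576, 82852207455775044,
20713051990157328, 5178262980466320, 331408830752129348, 5178262974731280, 66192064681467977872,
82852207376082960, 82852207561959748, 1325635321457050256, 1294565743072272, 1294565740134724,
82852207827457680, 5178262980536464, 331408830752200260, 1325635321457050128, 82852207376083268,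
331408831560443920, 5178262990111376, 82852207455704720, 1294565745726480, 1325635321457049924,
5178262990951440, 20713051995259204, 82852207829554832, 82852207368742928, 82852207556716868,
331408830839161488, 5178262973196432, 331408830839161360, 1325635321379526212, 5178262995354256,
82852207368743236, 82852207556716560, 5178262990952080, 331408830839161156, 82852207829554192,
66192067333605198352, 60032076239440, 12274692771580725535908, 240128267540560, 60032074974800,
749187791147540740, 960513134142544, 60032054069648, 240128287189072, 60032056590928,
60032076235344, 240128267544656, 60032074978896, 60032054077840]"

definition states15 :: "nat list" where
  "states15 = [
60032075049040, 960513134068304, 60032076376144, 240128267403856, 60032075049360, 960512682694224,
451226354925844, 7219635343681940, 2838505887312, 749174663174957476, 451225124612500,
1804906879418644, 47947174061080584452, 451225078735124, 28878555398179220, 11354352290192,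
2838505882192, 1804909852322196, 11986793544637563472, 451225078737300, 28878555398177044,
749174663129082276, 451226354991380, 7219635343616404, 2838505756240, 749174663175023012,
749174663175022996, 1804906879353108, 15368207439374416, 960513132882000, 749187788597403908,
240128268805200, 749187789918676132, 960513132877904, 26646156, 14927764260240, 960513132741200,
240128152901200, 240128268730960, 451225079857428, 28878555397056916, 11354351167888,
2996698659078547876, 451225126863124, 1804906877168020, 2838504761424, 451226353803540,
7219635344804244, 47947174113895260420, 2838504752720, 47947174192572613200, 1804909851191700,
451226447806740, 2996698662052571556, 240128275796560, 749187789801235620, 60032067983440,
60032058197584, 62948193669925609732, 60032052470864, 3842052899080592, 60032070854736,
240128205816400, 240128275792464, 60032067987536, 60032058201680, 15368207523260816, 60032058271824,
60032052396624, 240128275933264, 60032067846736, 60032058272144, 60032070784592, 451225113411860,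
7219636585195924, 177403423120, 177387771472, 177406748752, 709548737104, 177403422800,
177394423376, 2996698659162433956, 177406749072, 1804906961054100, 451225042977044,
11986793536072196356, 709619180624, 177403414096, 451226471244052, 28878554005670292, 177387768208,
177406743120, 709548742736, 177394427984, 177387766352, 451225113422228, 709619181968, 709548742224,
709619181648, 11986793545879077456]"

definition states16 :: "nat list" where
  "states16 = [
177394428304, 1804909968632212, 451226330366228, 177406744144, 2996698662170012068, 63124075587908,
397570413848592, 937601024656, 15001316562576, 937620247568, 1590281678913860, 115516447317961108,
29572210633798091028, 115516447317961124, 115516447268047252, 1848263160910979348,
26055174700640081936, 462065791316672788, 7393052654284335508, 115516447268350372,
115516447268350356, 1848263160910676244, 6513793683955935248, 26055174494481311760,
6513793752675751952, 192063204784077021328, 192063205172614433296, 11722607730793028,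
11722607742248592, 11722607737184912, 750246895441840144, 11722607730792772, 2930651926403396,
2930651931707408, 11722607742231184, 11722607737202320, 192063204786230796432,
192063205170460658192, 46890430898543172, 11722607739102864, 11722607743476368, 2930651930462224,
187561723338856772, 187561723799627408, 11722607730107024, 2930651930466628, 2930651927054352,
728328568340804, 2913314443727888, 182082154337936, 182082158740112, 2913314170890256,
2913313982916932, 28875826239406608, 728328483477060, 182082136582288, 2913314443728528,
728328648802628, 182082154337296, 28875826239406736, 2913314170890564, 2913313982916624,
104220699935606073360, 31473657872434664596, 98197545648672079254160, 5993502541871485252,
14101688373508, 14101692875856, 339489524963748, 21727329639244292, 84871868975268, 225626984654416,
14101670569616, 374587328462915620, 5993397258526499460, 14101670569552, 84871949387940,
1357954310054404, 5431828397709732, 14101679572048, 56406619869444, 383577406890041512260,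
14101688386640, 3525419831556, 339488715119012, 86908852834945188, 84871868998148, 902508197848656,
84872213340676, 14101692917328, 339489524943012, 95894351671826469524, 14101688395344,
84871949427204, 339488715114660, 86908852834949540, 14101679591684, 902508197839952, 14101688395408,
374587328462955140]"

definition states17 :: "nat list" where
  "states17 = [
1498349314769225764, 14101688897796, 14101693138000, 339489524439460, 21727329639506436,
84871868713124, 225626984392272, 14101670831760, 374587328463177764, 5993397258526237316,
14101670831696, 374587328463177892, 1357954309792260, 5431828398234020, 14101679309904,
56406619345156, 5993502536771211588, 5993502536771211920, 119359373132308, 339488719657380,
86908852843972772, 84871859970564, 902508193359440, 23973589045267990564, 1498349315574571652,
84871944886692, 5431828402210980, 84872047993348, 339489520425380, 21727329648271876,
84871859947684, 225626989143632, 383577406678782808388, 383577406730510422676, 84872217862660,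
339489520421028, 84871859952036, 225626989134928, 23973589045268030084, 1498349315574532132,
5993502536301449872, 32552765173961028, 84871851170212, 84872195514884, 21727191873751204,
56406749587024, 23973589045402208292, 374587328427303556, 5431828536428708, 84871913775620,
339488813373860, 902506922791172, 95894351678752002372, 84871913740708, 339489667958948,
84872070324740, 56406686967376, 1357954408292868, 84871851149476, 95894351661290377876,
5431828536467972, 84871913736356, 339489667963300, 56406686958672, 23973589045402247812,
374587328427264036, 505006019618064, 88273390180, 795141042906388, 88286037396, 353002347028,
88283173012, 5649579221140, 88273390100, 352999482772, 353002347108, 3180564182074640,
924131633834534480, 1390683530829648132, 236577698743241016400, 924131633834534544,
924131633634879056, 3696526539977426000, 5562734097986064644, 208441451913125438740,
347670881665306884, 3696526543517451344, 59144424669149505104, 924131633636091536,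
924131633636091472, 3696526539976213584, 5562734097983492356, 52110363097725969684,
208441453562394092820, 52110363647480571156, 1536505624823752627348, 120062476654100,
7683991035462036, 946209815927838107924, 120062456398436]"

definition states18 :: "nat list" where
  "states18 = [
120062456400404, 30015623930004, 30015603675284, 120062476655124, 7683991035463060, 120062456400484,
30015601543780, 30015622759828, 120062456470036, 30015623860372, 30015603744916, 120062476585492,
1536505624819470242964, 946209815923505391892, 5826642129847568, 14299368102864148,
231006605979048212, 5826641790392592, 231006606622740628, 14299368854758676, 833765816520578213140,
251792641778692760740, 47948020084007115284, 47948020043164457572, 2716129838065296,
173832309802436624, 2716126598830404, 679030410453648, 2996698682840326288, 10864483039877700,
11986794735031716368, 679030732104336, 10864483039877444, 2716126598826000, 43458061402203792,
3068619241925907094116, 2716126598686352, 695327376321618576, 679030410545168, 679031144487236,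
679031787915280, 679030732265796, 2716129837982352, 767154810170924079620, 679031787919684,
679030732261392, 2716126598668944, 695327376321635984, 679031787919940, 2996698682840484368,
11986794735031558288, 2716129835968144, 173832309803485200, 2716126597781828, 679030409405072,
2996698682841374864, 10864483040926276, 11986794735030667792, 2996698682841375376,
10864483040926020, 2716126597777424, 43458061404300944, 47948020083966646884, 47948020043204925972,
47948020083966644372, 955725050611792, 2716126616839824, 695327376357728912, 679030374434832,
679031126530372, 191788715796346445968, 679030374439492, 11986794738252941840, 679030714099344,
43458061420208784, 679030374439236, 679031126525968, 2716129819911824, 173832309838546960,
2716126616787268, 679030374343312, 3068619241080872278628, 3068619241080872245764, 679031806003216,
679030714177860, 2716129819894416, 679030374360720, 191788715796346604048, 679030714178116,
11986794738252783760, 47948020085308821652, 47948020041862748692, 679030339233424, 679031716612112,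
679030589659460, 173831758740464272, 191788715796883316880, 679031716616772, 2996698682697878032,
43458061957079696]"

definition states19 :: "nat list" where
  "states19 = [
679031716616516, 679030589655056, 2716126991705744, 767154810148643969636, 679030589515408,
2716130410046096, 679031215851536, 679030339180868, 2716126991779856, 10864482860833092,
679030339150480, 767154810148643936772, 2716126991784260, 43458061957236752, 679030589498000,
2716130410063504, 2716126991784516, 191788715796883474960, 2996698682697719952, 4040033416151316,
63125516986772, 177402554768, 6361128120887716, 709626435152, 177407617104, 709614977616,
709552931408, 177402554448, 177396160080, 177407617424, 25444512387131796, 63125489008916,
695341751583803412, 115516453456978580, 695341751264778596, 1892621572422197405332,
43458859458184212, 695341751583803924, 115516453456978068, 28879113344328340, 43458859424647188,
115516453373109908, 10864714857202708, 173835437575018852, 1667531566930791049636,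
173835437373561188, 10864714856875028, 462065813575788180, 173835437579864084, 115516453496038036,
462065814038913172, 43458859419208212, 462065814038913684, 43458859419207700, 462065813988402836,
10864714846913556, 173835437579868516, 416882891591963126180, 1667531570229331372452,
416882890492446058916, 60032059462224, 12292045228646974727332, 60032051206224, 61472811696326224,
7569678744405896896772, 60032069248080, 960513068632464, 960513068640336, 60032073368144,
60032059458128, 60032051210320, 61472811696330320, 960513068640656, 60032050932112, 60032068687440,
960513068918864, 60032073089616, 60032059736656, 60032050931792, 12292045228629643863204,
7569678744371436495108, 46613123868748180, 114394897645316516, 1848052904880513284,
46613122510915988, 1848052906097459792, 114394900652894628, 6670126249594432268708,
33096022276587464964, 33096022194902149252, 21042404401300, 21042548476436, 21043835061652,
21042548476516, 21043763024020, 5260406266388, 21043763058196, 5993397351545640084, 21043835077220,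
5993397352760240404]"

definition states20 :: "nat list" where
  "states20 = [
21042548457876, 21043763059220, 5260406231188, 21043835079268, 21042548458900, 21043835079188,
5260334211220, 24548954154033832159632, 21042404035092, 21042548842644, 21043835637908,
5260333652500, 21043763234196, 21042404035172, 5260333565332, 5260405934692, 21042404069524,
21042548808212, 813828168734812484, 1534309634173862701072, 5260333582948, 5260405917076,
21042404104724, 21042548773012, 21043835707540, 5260333582868, 5260333580900, 5993397354119194900,
5260405916052, 21042404103700, 5993397352904594580, 21042408595604, 21042544282132, 21043839255956,
21042544282212, 21043771412628, 5260397877780, 21043771446804, 5993397351537251476, 21043839271524,
5993397352764434708, 21042544263572, 21043771447828, 1498349337986797716, 21043839273572,
21042544264596, 21043839273492, 5260330016916, 33096022276506527876, 33096022194983086340,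
33096022276506523140, 24548954150653692897680, 3255313366211963204, 24548954150653692766224,
33096022274359039492, 33096022187466893572, 21043478143124, 84168904051220, 84173411861908,
84168904051300, 21042689282196, 21042689316372, 5993397352619381908, 84173411877476,
5993397353833982228, 84168904032660, 21042689317396, 84173411879524, 84168904033684, 84173411879444,
6137238537177126824336, 21043477776916, 84168904417428, 84173412438164, 21042689492372,
21043477776996, 21043477811348, 84168904382996, 813828000157346116, 6137238537177126692880,
21043477846548, 84168904347796, 84173412507796, 23973589415837198612, 21043477845524,
23973589410327630996, 12426255421700, 12426189341776, 32320198591666596, 31562695811588,
126250788391076, 505007490246224, 3180563997762180, 12722255996192804, 505007490246288,
505007510496848, 126250808641700, 203556095968453124, 126250807613860, 12426169091152]"

definition states21 :: "nat list" where
  "states21 = [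
12426214920452, 86917717940659460, 5562733943932863908, 924131623782685188, 21729429481132196,
5562733951155052676, 86917717966228004, 347670871635796132, 15140972528122605898244,
21729429500356004, 347670871929799940, 86917717940660484, 5562733943932862884, 924131623782684164,
21729429481133220, 231032905975044612, 21729429501317284, 347670871460177156, 21729429500216740,
231032905928051204, 347670871749828772, 86917717967398308, 21729429500216580, 21729429479000612,
1390683485720944772, 33095882335709143684, 1390683486524416132, 21729429480835620,
21729429500740868, 86917717966874020, 1390683486524416164, 231032905929886212, 86917717873935780,
1390683485699204356, 21729429500006564, 924131624233572868, 231032906016200196, 1390683485901231268,
347670871479576836, 21729429480817060, 231032906016201220, 1390683485901230244, 347670871479575812,
21729429480818084, 3696526496967461380, 347670871728070820, 21729429479384484, 86917717854012676,
21729429500758564, 1390683485699186820, 33095890468767860772, 33095886070721349668,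
33095886733755654788, 98336362702594296418960, 60557430839637134709060, 98336362702524972962448,
60557430839567811252548, 23306557648930980, 915158953265268772, 14299358237663876,
14784423450942738756, 14784423450660983444, 915158953265308292, 14299358237624356,
264768191789449453892, 264768191135966930500, 168557135037008, 168557711337552, 168562857678416,
168557711337872, 168562569527888, 42138504423504, 168562569664592, 47947179039981675684,
42138504286800, 168562857740688, 168557135111248, 11986794758927851780, 168557711263312,
168562569668688, 42138504282704, 168562857748880, 168557711267408, 168562857748560, 42138216202832,
12274477059926163327124, 26042312928597156372, 168557133572176, 168557712802384, 168562859983440,
42138213967952, 168562570368592, 168557133572496, 42138213619280, 42138503096720, 168557133709904,
168557712664656, 6510575612999567972, 12274477059926163588500, 42138213689744]"

definition states22 :: "nat list" where
  "states22 = [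
42138503026256, 168557133850704, 168557712523856, 168562860261968, 42138213689424, 42138213681552,
168562570929232, 47947179045706834180, 42138503022160, 168557133846608, 11986794760920212644,
168557712527952, 168557151814224, 168557694560336, 168562874455632, 168557694560656,
168562603082320, 42138470869072, 168562603219024, 47947179039998452900, 42138470732368,
168562874517904, 168557151888464, 11986794758911074564, 168557694486096, 168562603223120,
11986794760338740740, 42138470728272, 168562874526096, 168557694490192, 168562874525776,
42138199425616, 264768191788801959492, 264768191136614424900, 264768191788801919300,
66192047929044785168, 1627643386856514068, 196391632977566194862228, 26042296097183435364,
196391632977566195123604, 264768191810276755780, 66192047920454850576, 264768191115139588420,
168561430004304, 674225685932112, 674243717174864, 674225685932432, 168558274560592,
168558274697296, 47947179044276642980, 674243717237136, 168561430078544, 674225685857872,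
168558274701392, 674243717245328, 674225685861968, 674243717245008, 49097908245757131098260,
1627643365381677588, 168561428539472, 674225687396944, 674243719479888, 168558275401296,
168561428539792, 168561428677200, 674225687259216, 6510575969481853540, 49097908245757131359636,
168561428818000, 674225687118416, 674243719758416, 168558275961936, 191788716175106023684,
168561428813904, 674225687122512, 258562471072196240, 252502428885648, 25444512836258320,
25444512844488848, 252502442779280, 1628448821967226896, 252502438667920, 43458859824157712,
695341756780675396, 44501872433801795216, 7393053045473830928, 2781367028039166276,
43458859814371984, 44501872457586153028, 695341756780675600, 695341757147261072,
2781367027672580752, 45569917371122665810244, 29572212185316337680, 43458859824158352,
695341756699656516, 2781367028848595984, 43458859824161808, 695341756780683588, 44501872433801791120]"

definition states23 :: "nat list" where
  "states23 = [
7393053045473826832, 7393053046466545988, 43458859814376080, 1848263261485950992,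
695341756691130692, 43458859828003472, 695341757151941648, 2781367028128710980, 43458859823601296,
695341756879104324, 1848263261297977360, 2781367028128711312, 695341757151942288, 43458859823600656,
173835439325856068, 43458859805845648, 11125468110537725508, 2781367028128711184,
264767966289299147280, 11125468110615249424, 2781367028041750084, 43458859813185680,
10864714948297028, 10864714951234576, 695341757149845136, 11125468110615249552, 1848263261305317392,
695341756884347204, 695341756778092176, 11125468110615249220, 10864714953888784, 43458859822760592,
695341756698470724, 7393053047277381648, 462065815472461840, 1848263261385001284,
11125468108122509968, 43458859807384592, 2781367028041687364, 43458859813111440, 462065815472465936,
695341756778162500, 11125468108122505872, 43458859807380496, 2781367028041679172, 43458859813115536,
11125468114724481348, 462065815475333136, 2781367028041679504, 43458859807381136, 43458859813114896,
695341756884205892, 173835439323621520, 11125468110615320132, 11125468107314332176,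
264767998821534015632, 264767981229347971216, 264767983881485191696, 484459445585762945372308,
786690900588885816515092, 484459445585762945374820, 484459445586314311798932,
786690900588334450088468, 484459445586314311801444, 186452515844792976, 7321275059787800720,
114394921180760592, 118275387418546313828, 118275387418546280964, 7321275059787958800,
114394921180602512, 2118145588717219644688, 2118145586103289551120, 98195816419031269336580,
208337524336580008196, 52084351011909625988, 98195816419031268278788, 95894358299236390928,
2118145588714629667088, 2118145586105879528720, 2118145588714629506320, 529536397057426990356,
13021086713339353348, 1571133062841440837133828, 208337389688742570116, 1571133062841440836076036,
2118145588800528852240, 529536397143326336276, 2118145586019980182800, 392783265708041796412932,
13021086593080269060, 52084349740599306372, 392783265708041795355140, 122943888013533332,
120062466134164, 203556101756184852, 12722256369489044, 120062466169364, 3256897628193965460,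
120062338539668]"

definition states24 :: "nat list" where
  "states24 = [
353009968532, 225619625510160, 361535656009876, 59144424588610938132, 902482167899408, 353137741972,
14439750524360976, 353009967716, 5562734041719265556, 5650370897428, 353098597524, 353137744404,
13027564132696871060, 364559342587402885113104, 236577698331093476628, 22600492320148, 353009967252,
353137744484, 225619301434640, 22594016880020, 353009935764, 225619625542928, 361535655993492,
59144424588610905364, 59144424588610905360, 353137758356, 3689374334919010580, 3689474027558343828,
228895038162223696, 15139357661259843900932, 6293527200846927375182084, 228895038162233744,
15139357661259843905668, 60557430646703394264580, 15139357661169730529540, 937554077830409775504,
60557430646703394269316, 228789829585147028, 228789830799747348, 23865899149187770768,
23865899066795043140, 23865899149187639312, 915159323700259092, 915159318190691476,
4236291159141289847188, 16945164646058526654740, 4236291159971103541652, 16945164640830666449172,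
104169614616152803652, 785566532260991877879824, 1666714133829018853700, 416678491550859175492,
104169614616156985668, 785566532260991873648656, 767154866170305611156, 4236291159146469820820,
16945164646053346681108, 4236291159965923568020, 16945164640835846422804, 4236291159146470123924,
16945164646053346378004, 4236291159146470123940, 104169614625420747076, 1666714133819750910276,
196391633075009613043728, 1666713864526399317572, 1666714133819755092292, 196391633075009608812560,
4236291159283909077396, 16945164645915907424532, 4236291159283909077412, 16945164640928021899668,
4236291159873748091156, 416678555304255850820, 196391633074872174090256, 104169614281823363396,
416678497254575744580, 416678555304260032836, 196391633074872169859088, 25444512942301444,
960512597271632, 25444512938173604, 26055181247392585296, 960512597197392, 2837969016400,
1804906899521812, 451225104509332, 473155396486908094884, 451226334822676, 7219635363785108,
115514230551617812, 451225038522772, 2837969013136, 44501872545840505092, 104220513916138111568,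
2916474737322691654068628, 451225038520596, 1892621585892896156068, 2837969011280, 1804906899532180]"

definition states25 :: "nat list" where
  "states25 = [
2837968885328, 1804906899587348, 451225104443796, 473155396486908160420, 451226334757140,
473155396486908160404, 1831160258325795476, 121114861510350802061636, 104220390135420180496,
50348217662323116161999172, 1831160258325776532, 121114861510350802101828, 484459446044861628221764,
416881567197755365392, 121114861509681434698052, 245677113981667476, 484459446044861628261956,
1830318860002763940, 457579712859382020, 190927189912130291860, 190927189216924836372,
190927189582560168548, 190927189912130553236, 7321275438010507524, 457579714851742884,
33890329500040931944016, 33890329507436444537092, 135561318038137196840016, 33890329503360186721872,
33890329500797935128836, 135561318017225756017744, 7868705889681810704, 6284532261771609846719764,
125900494117204952336, 31474955903719086352, 7868705889698538768, 6284532261771609863447828,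
33890329500061651838544, 33890329507395004895492, 135561318038116476945488, 33890329503339466827344,
33890329500839374770436, 135561318017246475912272, 33890329500061653050960, 33890329507395002323204,
135561318038116475733072, 33890329500061653051024, 7868705926753584400, 125900494080133178640,
1571133065469001960924436, 125899416906726807824, 125900494080149906704, 1571133065469001977652500,
33890329500611408864848, 135561318038713143546116, 33890329507622968230992, 33890329500611408864912,
135561318017615177819728, 33890329499464985235716, 33890329502970764919888, 31475210917305787664,
1571133065470376350459156, 7868704552364049680, 31474978718585362704, 31475210917322515728,
1571133065470376367187220, 776504914756, 48531557168, 208441450878236428308, 5431828236884388,
1357954390467076, 3785243170938932273796, 339489685789092, 21727329558831620, 347635495293229476,
339488795543716, 902506050365008, 356014981265817440580, 833764114632019694228,
23331797884995962929481892, 339488795548068, 902506050356304, 15140972683840004098084,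
5431828236863652, 5431828236360100, 1357954390729220, 3785243170938932011652, 339489686313380,
21727329558569476, 14649281814839433732, 968918892990448833668368, 833764002171564860692,
402785741523584411937178896, 14649281814839518724, 968918892990448833829136,
3875675571975629014574352, 3335056022519939343636, 968918892987771364214032,
3875675571975629014735120, 1527417503174348072452]"

definition states26 :: "nat list" where
  "states26 = [
1527417501783937161476, 1527417500537783937156, 1527417503174347014660, 461850496283609108,
271122635801403030250132, 120006908330241354537316, 480027633302539755677332,
67780658945278594860052, 461837219265087508, 67780658948306591883924, 271122635795347020487012,
1847330451386418196, 67780658945278584579732, 62946339860570515860, 15736518354180604180,
50276258090865621889788324, 15736428704701901204, 1007141291037016080660, 15736512341796856084,
251785092998366267796, 62946339860638214548, 15736518354112905492, 50276258090865621957487012,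
461850413404620820, 271122635801485909238420, 120006908330324234115428, 480027633302705514243732,
67780658945112836293652, 461837302144075796, 67780658948223712895636, 271122635795264140908900,
117948360234714132, 67780658945112826013332, 461850413399181332, 271122635801485914677908,
120006908330324238965092, 480027633302705524532884, 67780658945112826004500, 461850413399181844,
271122635801485914677396, 62946339786426968468, 15736518428324151572, 15736428778845448596,
1007141290962872533268, 12569064522560219175266724, 15736428778913145108, 1007141290962804836756,
15736428778913147284, 1007141290962804834580, 12569064522560219242965412, 271122635802960722298900,
6670112753089201316500, 480027633301793660901732, 67780658950610384143380, 120006908327937567712916,
271122635802960722299412, 6670112753089201315988, 1847329705281357844, 67780658946024689640084,
271122635802960722303332, 67780658950610384152212, 29489351245251604, 15736430977868704148,
251785174362294419732, 12569064522562418198522276, 62946347483008362900, 15736510731742757140,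
15736430977936400660, 251785174362226723220, 15736430977936402836, 251785174362226721044,
12569064522562418266220964, 43458060758902416, 2716126920476688, 10864482718226756,
2716126920481348, 30281945381184468322832, 2716130481366672, 2716126920481092, 173832309480785936,
2781309841100269200, 2716126920385168, 2848119849215720987236, 6670112913852469877252,
186654383303983780861321872, 2716126920402576, 121127781525074973302928, 43458060758819472,
43458060756805264, 2716126921525264, 10864482717178180, 2716126921529924, 30281945381184467274256,
2716130483463824, 2716126921529668, 173832309479737360, 117194258057493768208,
6670111221674060097940, 1937837785766833632411924, 6670111221674060097956]"

definition states27 :: "nat list" where
  "states27 = [
3222285931904671145625938324, 1937837785761684851933460, 117194258057494108176,
6670111221674059794836, 1937837785766833632715028, 26680444780199046097300,
1937837785766627473981716, 26680444780199046097316, 6670111227441315867028,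
1937837785761066376642836, 26680444780199045794196, 1937837785766627474284820,
12219340243244524013892, 7496973760086365542416, 12219340232121236726084, 12219340237971402040900,
12219340243244528195908, 7496973760086361311248, 923477634730059012, 91075462575441316,
2168981085395642204133892, 22735299969093796, 240013816446418271477892, 91022354479614500,
240013816446418271477924, 213443604504708986735108, 542245271367336213505444, 22747411978929412,
923460374062327044, 91022354498995620, 542245271379448264462500, 13340225263526621583876,
542245271367336235245700, 91075462553700900, 22740448588228004, 14775571889493918980,
542245271367336235245732, 13340225275638650800644, 7868028382205813252, 31472157544022608036,
52119073339511820548, 7868005815884994980, 402210064710464553247416964, 25138129044420424682244132,
7868011086593958404, 31472104470890285220, 8056841820825781950884, 31472157543484168612,
2014218085594979262980, 7868005815617341604, 7868028382744257028, 31472157543484164260,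
7868005815617345956, 13029863996537308240, 402210064710464553785860740, 25138129044420424143800356,
923477966248371460, 91075131057128868, 2168981085396305238399492, 22734636934828196,
240013816446086755524740, 91022685995567652, 240013816446086755524772, 213443604505040502688260,
542245271367667731817892, 923467005934716164, 923460042544014596, 91022686017308068,
542245271380111298728100, 13340225262863587318276, 542245271367667751198852, 91075131037747748,
22740117069915556, 364053413426644228, 542245271367667751198884, 13340225275307134847492,
923477966267770116, 91075131037730212, 2168981085396305279556100, 22734636893671588,
240013816446086733766788, 91022686017325604, 240013816446086733766820, 213443604505040524446212,
542245271367667751216548, 923467005915317508, 923477966267771140, 91075131037729188,
2168981085396305279555076, 22734636893672612, 7868028678780002820, 31472157247448418468,
7868005222736615844, 7868010790019768836, 31472104767464474788, 8056841821418930330020,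
3257445104216068356, 6284532261076510184678020, 25138129044367648124110884, 31472104766926035364]"

definition states28 :: "nat list" where
  "states28 = [
8056841821418662676644, 7868005223004267012, 7868010790558212612, 31472104766926031012,
8056841821418662680996, 3257457425422353488, 6284532261076510723121796, 25138129044367647585667108,
2168981085392657825031428, 22738284348196260, 91084677722738852, 13340225276720802273796,
3840221063354827279048836, 22734217839413796, 542245271376463844238756, 923458209822295300,
960055265852463903285412, 13340225262444533025284, 2168981085392657825032452, 22738284348195236,
91084677722739876, 13340225276720802272772, 14775578120242750724, 22734217839396260,
13340225284853819873796, 542245271358121066172580, 2168981085392657825013892, 22738284348213796,
542245271376463844221092, 13340225266511041825284, 91028585247827364, 22734217839396100,
125888388248798077444, 7868004646648350884, 814369849716396292, 2014209056998372694436,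
100552516177439771436622468, 6284532261070366813259812, 503554267555360449028, 7868008748120672420,
31472166916203895204, 7868004646109911460, 7868027213236822532, 2014209056998105041060,
125888388249336521220, 7868004646109907108, 2014209056998105045412, 814368976783148112,
100552516177439771975066244, 6284532261070366274816036, 22784958807465223416208, 203457567297710404,
53360903366340656523280, 937554078910662354196, 53360903986345156060752, 15502702289817506175668484,
15502702289748464909026384, 53360903986345156060816, 25778287458961683190584026704,
15502702289776315931840772, 15502702289727869787112528, 937554078910661141780,
53360903986345154848336, 15502702289817506178240772, 15502702289748464910238800,
213443615519391847065168, 15502702289819155443110148, 15502702289747640275305552,
213443615519391847065232, 53360904009414179137104, 15502702289774666664399108,
15502702289725395885950032, 213443615519391845852752, 15502702289819155445682436,
15502702289747640276517968, 97754722815047043786000, 59975790952089882076436,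
97754722770553894634768, 97754722793954555894032, 97754722815047060514064, 59975790952089898804500,
185606429198619664, 7391296790398009668, 742604219000886928, 66192049782226577424,
29565429401788754244, 185516792051155600, 7391365832991413828, 1920110535185143916167696,
742391786617579664, 1920110535185143916167824, 118260185482707495236, 426887223295040813148176,
4337962174483444858984080, 185516792051155268, 185565240090498064, 7391365833078374724,
185537386527691792, 742391786695104144, 4337962174531893062812304]"

definition states29 :: "nat list" where
  "states29 = [
106721805742605435562000, 7391324643796330820, 4337962174483444945945104, 7391296790320485956,
742604218913925264, 185537386527692432, 118260185482871980356, 742391786695103504,
4337962174483444945945232, 7391276195679463748, 106721805791053552429072, 62947771324515649552,
62947702142068234564, 251791261358860018320, 62947681059232376464, 3217680517908781499519765008,
62947702142068234820, 201105032369364404137107600, 62947771324515653956, 62947702142068230160,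
251791049066330727056, 64458440866092141864592, 251791261356706260624, 16114640738077170567184,
251791049065247578436, 62947681058161762960, 62947771326669424656, 62947702143151413572,
251791261356706243216, 62947681058161780368, 3217680517908781501673540112, 62947702143151413828,
201105032369364401983332496, 185607755271869456, 7391295464334197060, 742602892927637136,
16548012445223249936, 29565430727852566852, 185514139914093200, 7391367159064663620,
1920110535183817852355088, 742393112681392272, 1920110535183817852355216, 118260188134844557636,
426887223296366876960784, 4337962174484770932233872, 7391273543706886468, 185563914017248272,
7391367159142187332, 185536060454442000, 742393112768353936, 4337962174534545199874704,
106721805739953298499600, 7391323317732518212, 4337962174484771009757712, 7391295464247236164,
742602892850112656, 185536060454442640, 2968037674324345156, 742393112768353296,
4337962174484771009757840, 7391273543542401348, 106721805789727488616464, 185607755349464080,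
7391295464247165252, 742602892850042512, 4137003111406790672, 29565430727939598660,
185514139749466768, 7391367159142258244, 1920110535183817765323280, 742393112768424080,
1920110535183817765323408, 118260188135009184068, 426887223296366963992592,
4337962174484771009828496, 7391273543542260036, 185563913939653648, 185607755349468176,
7391295464247173444, 742602892850038416, 4137003111406786576, 426887223296366963984708,
185514139749470864, 62947772510812407824, 62947700955771476292, 251791260172563260048,
62947678686638859920, 62947772510812412228, 62947700955771471888, 251791050252627485328,
64458440868464735381136, 62947772510812412484, 50276258092226717090744848,
201105032369153297904574608, 251791050250473727632, 64458440868463664767632, 62947678687709464592,
62947727971464026436, 62947772511895591236]"

definition states30 :: "nat list" where
  "states30 = [
62947700957925246992, 251791050250473710224, 64458440868463664785040, 62947772511895591492,
50276258092226719244519952, 201105032369153295750799504, 29565454324861534532, 1034250777828889616,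
185528729567565456, 742641079590077072, 106721805795382158321680, 7391271867325229380,
7680442141007738934166032, 118260173545191085636, 185512463532435600, 4337962174519955381917328,
7391361504472482116, 185528729567564816, 7680442141007738934166160, 7391328972402223428,
106721805738277081327632, 29565454324861542724, 1034250777828893712, 185528729567561360,
742641079590081168, 106721805795382158317584, 106721805738277081319748, 742416709690430480,
118260173545191014724, 185512463532365456, 106721805827914228721680, 7391288133360429380,
4337962174446584269652624, 29565454324861605444, 4337962174519955381846544, 185528729567635600,
4337962174519955381846672, 7391361504472623428, 106721805754543116527632, 742416709690431120,
185569568609288516, 185512463532364816, 251791074826113157136, 1007162653945497819460,
62947676382285800080, 16114604623690744293008, 201105032369177871390247440, 1007162653945497819716,
50276258092202143605072016, 251791074826113161540, 4028659169145755174928, 62947692788175086224,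
251791298847585166992, 62947676380132042384, 62947766648639686672, 62947692787091937604,
16114604623689673679504, 251791074828266932240, 1007162653946580998468, 62947676380132024976,
16114604623689673696912, 201105032369177873544022544, 1007162653946580998724,
50276258092202141451296912, 45569917610873134293524, 106721806716563153356948, 1627642962217863780,
426887226873898524345748, 7500432616995942574500, 461848214375925780, 426887217340928173023892,
7751351144646571392670052, 7389738769064739860, 31005404578573191697491604, 461848214375926292,
426887217340928173023380, 461836202632448020, 3146763605780331903853204,
124021618314898453807143268, 124021618314704669228230292, 117949459746341908,
7500432616995937135012, 461848214381365268, 426887217340928167584404, 7751351144646571387820388,
7389738769075029012, 31005404578573191687202452, 7389942449248307220, 7389745366134506516,
7389942449248307732, 426887217420010125795988, 124021618314908349411793252,
124021618314711266297996948, 7389942449253746708, 6670112753089195877012,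
31005404578571180317383012, 7389745366144795668, 7751351144645284222756500, 48877361334168770412820,
479806326416126451460516]"

definition states31 :: "nat list" where
  "states31 = [
782037781408770043439508, 782037781488523849795988, 48877361334168702714132,
479806326416126519159204, 25138129045898693831890068, 25138129045898698114274452,
364559340871065063037188, 853774453681198160504324, 13021092390673410180, 3415097814746367078777348,
13643207436, 923473568221259012, 91079529084241316, 22730238847160484, 3415097676055629307156996,
15502702289071983971410052, 91031482110347812, 1456939017832129956, 923471403961828612,
15502702289071983971410084, 213443604513836617468420, 923473568221260036, 91079529084240292,
22730238847161508, 3415097676055629307155972, 923451246450992388, 91031482110330276,
13340225258465540807172, 25174108846032578779877540, 992172946502741449482313860, 91079529084258852,
992172946502741449482313892, 13340225279705181358596, 22731320976893348, 364062209519666436,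
923473568201860356, 91079529103639972, 22730238888317092, 3415097676055629266000388,
15502702289071983993168004, 91031482088589860, 1456939017812731300, 923471403981227268,
15502702289071983993168036, 213443604513836595710468, 59103027442314011908, 1456952211971663268,
59103027442314012932, 5819796008208765092, 992172946502754643621847172, 992172946502754643621847204,
59103027442294613252, 22738284367594916, 91084677763895460, 13340225276720761117188,
248043236625509920591454340, 22734217817655844, 1456952211952264612, 923458209841693956,
62010809156391237247705252, 13340225262444511267332, 391018890463412962744740,
3838450608269437460128388, 239903162997220939728932, 1564075561814052372259332,
391018890463412695091364, 391018890463412695095716, 3838450608269437998572164,
239903162997220401285156, 201105032370867693001745572, 201105032370867710332609700,
2916474727202244442857796, 104169602521524898116, 6830195630346232379316240, 104169607831202342468,
416678532420674279748, 6830195630346232375085072, 7391260279875076420, 185590163163419664,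
742620485036086928, 185496547563422352, 27320782304478248230610960, 29565465912311687492,
124021618316226180038558224, 7391349566956213828, 742428297140512912, 11880593970514466448,
7391255951356215620, 185581506125698064, 124021618316226180038558352, 118260205727195228484,
426887223331551336081424, 7391260279875084612, 185590163163423760, 742620485036082832,
185496547563426448, 27320782304478248230606864, 426887223331551336073540, 185500876082353168,
7391349566956142916]"

definition states32 :: "nat list" where
  "states32 = [
742428297140442768, 106721805722361112455184, 7391340909918562628, 201392870771736692863025808,
7391260279875147332, 7937383572247013423716008464, 742620485036157072, 7937383572247013423716008592,
7391255951356356932, 106721805807319674660880, 185500876082353808, 2968055266510389572,
742428297140442128, 7391260279962108228, 185590163085825040, 742620485113681552, 185496547728048784,
27320782304478248065984528, 29565465912224655684, 124021618316226180125590032, 7391349566878619204,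
742428297053481104, 11880593970436871824, 7391255951520842052, 185581506203292688,
124021618316226180125590160, 118260205727030602052, 426887223331551249049616, 11880646747072599056,
11880646747072599696, 11880646747072603152, 47490535629578846864, 7937383572247066200274141712,
7937383572247066200274141840, 29565454324948566340, 11880646746995004432, 185528729645160080,
742641079754703504, 106721805795381993695248, 7391271867238197572, 496086473265317925602492944,
118260173545113491012, 185512463445403792, 11880646746995005072, 7391361504637108548,
185528729645159440, 496086473265317925602493072, 7391328972237596996, 106721805738276994295824,
3128151127289059296241296, 7676901230837203437259280, 1919225307616976616824976, 186452336742402064,
3128151127289058225627792, 3128151127289058225645200, 7676901230837205591034384,
1919225307616974463049872, 1608840258980903618253066896, 1608840258980903687576523408,
23331797818510373944853776, 7868657511170188560, 54641565046308398323344660, 7868678749879965968,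
31475119382979503376, 54641565046308398340072724, 959612653606110337766548,
959612653606114620150932, 12870722071830715956971837972, 12870722071830716508338264596,
186654382547242668049852820, 15736426069347418388, 62946146346524027284, 15736430393250382100,
437132520367353443749276068, 62946146346591723796, 15736430393182685588, 62946146346591725972,
251785286512412754196, 437132520367353443816974756, 7676901232527025048757412,
7676901232527042379621540, 6435361035911444878462626052, 93327191273354157143492772,
31472109741599250852, 503554247921275308196, 13029869267517067524, 218566260182771634053161604,
3497060162923904699077298212, 503554247920736868772, 125888387079829086724, 503554247920736864420,
833914689982472258640, 218566260182771634591605380, 3497060162923904698538854436,
61415209874178274629161616, 61415209874178343952618128, 51482888287347106724861550916,
746617530190350507241382544, 251791070149166589584, 4028659090609414611600]"

definition states33 :: "nat list" where
  "states33 = [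
1748530081476131913432730128, 27976481303616344831830532240, 4028659090607260853904,
251791070150237194256, 1007162644590521522500, 4028659090607260836496, 1748530081476131915586505232,
27976481303616344829676757136, 491321678976913207980595732, 491321678976913759347022356,
411863106299001853281533592848, 245660839484543503967004932, 1707548451299024208685460,
1965286715931895728896581956, 13660391334706219246003792, 15722293727680165313813841168,
109283127511623701152408212, 1491926634635458842788, 12165812547308244714128]"


definition states :: "nat list" where
  "states = states1 @ states2 @ states3 @ states4 @ states5 @ states6 @ states7 @ states8 @ states9 @
    states10 @ states11 @ states12 @ states13 @ states14 @ states15 @ states16 @ states17 @
    states18 @ states19 @ states20 @ states21 @ states22 @ states23 @ states24 @ states25 @
    states26 @ states27 @ states28 @ states29 @ states30 @ states31 @ states32 @ states33"

section \<open>Appending a letter to a state\<close>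

definition covered :: "letter list \<Rightarrow> curl list \<Rightarrow> bool" where
  "covered s t \<longleftrightarrow> (\<exists>n\<in>set states. prefix (state_letters n) s \<and> prefix (state_curls n) t)"

text \<open>Curling numbers are invariant under renaming, so only \<open>s\<close> is made
  canonical.\<close>

definition enters :: "letter list \<Rightarrow> curl list \<Rightarrow> bool" where
  "enters s t = (if all_parallel avoided t then covered (canonical s) t else False)"

text \<open>\<open>s\<close> already has the new letter at its head, whereas \<open>t\<close> still
  lacks its curling number. The early answers \<open>True\<close> are the cases that contradict
  \<open>good\<close>. A visible square forces \<open>Two\<close>. If \<open>Two\<close> would be
  repetitive, \<open>One\<close> is forced; otherwise \<open>One\<close> has to be justified by
  mismatches for all periods up to 12 and by excluding the windows.\<close>

definition step_letter :: "letter list \<Rightarrow> curl list \<Rightarrow> bool" where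
  "step_letter s t =
    (if some_agree overlap_lags s s then True
     else if some_agree square_lags s s then
       (if repetitive (Two # t) then True
        else if some_short_agree (square_bound (Two # t)) square_lags s s then enters s (Two # t)
        else False)
     else if repetitive (Two # t) then
       (if repetitive (One # t) then True else enters s (One # t))
     else if all_apart short_lags s s then
       (if windows_ok windows s t then
          (if repetitive (One # t) then True else enters s (One # t))
        else False)
     else False)"

definition step :: "letter list \<Rightarrow> curl list \<Rightarrow> bool" where
  "step s t = (if step_letter (La # s) t then
    if step_letter (Lb # s) t then step_letter (Lc # s) t else False else False)"

section \<open>The invariant and its preservation\<close>

definition matches :: "nat list \<Rightarrow> letter list \<Rightarrow> curl list \<Rightarrow> bool" where
  "matches r s t \<longleftrightarrow>
     (\<exists>f. naming f \<and> prefix (map f s) (r @ [3])) \<and> prefix t (marked r)"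

lemma has_start_iff: "has_start s \<longleftrightarrow> Lstart \<in> set s"
  by (induction s) auto

lemma apart_no_square:
  assumes "apart p s (drop p s)" "naming f" "prefix (map f s) (r @ [3])" "3 \<notin> set r"
  shows "\<not> rep p p r"
proof (cases "drop p s")
  case Nil
  \<comment> \<open>At most \<open>p\<close> entries are known and the marker is one of them, so its
    index, which is the length of the word, is below \<open>p\<close>.\<close>
  then have "Lstart \<in> set s" using assms(1) by (simp add: has_start_iff)
  then have "3 \<in> set (map f s)" using assms(2) by (force simp: naming_def)
  then obtain i where i: "i < length (map f s)" "map f s ! i = 3"
    by (metis in_set_conv_nth)
  moreover have "map f s ! i = (r @ [3]) ! i"
    using assms(3) i(1) by (metis nth_append prefix_def)
  ultimately have "length r \<le> i"
    using assms(4) nth_mem by (metis nth_append leI)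
  then have "length r < p" using i(1) Nil by simp
  then show ?thesis by (auto simp: rep_def)
next
  case (Cons b v)
  then have "disagree p s (drop p s)" using assms(1) by simp
  then have "disagree p (map f s) (drop p (map f s))"
    using assms(2) by (simp add: drop_map disagree_map naming_def)
  from disagree_marked[OF this order_refl assms(3)] show ?thesis .
qed

lemma enters_matches:
  assumes "enters s c" "naming f" "prefix (map f s) (R @ [3])" "prefix c (marked R)" "s \<noteq> []" "hd s \<noteq> Lstart"
  shows "\<not> prefix_of_some avoided (marked R)"
    "\<exists>n\<in>set states. matches R (state_letters n) (state_curls n)"
proof -
  have "all_parallel avoided c" and cov: "covered (canonical s) c"
    using assms(1) by (auto simp: enters_def split: if_splits)
  then show "\<not> prefix_of_some avoided (marked R)"
    using parallel_prefix[OF _ assms(4)] by (auto simp: all_parallel_iff prefix_of_some_iff)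
  obtain g where g: "naming g" "map g (canonical s) = map f s"
    using canonical_naming[OF assms(2,5,6)] by blast
  obtain n where n: "n \<in> set states" "prefix (state_letters n) (canonical s)" "prefix (state_curls n) c"
    using cov by (auto simp: covered_def)
  have "prefix (map g (state_letters n)) (R @ [3])"
    using map_mono_prefix[OF n(2), of g] g(2) assms(3) prefix_order.trans by metis
  moreover have "prefix (state_curls n) (marked R)"
    using n(3) assms(4) prefix_order.trans by blast
  ultimately show "\<exists>n\<in>set states. matches R (state_letters n) (state_curls n)"
    using n(1) g(1) by (auto simp: matches_def)
qed

text \<open>The first part describes the word locally, the second places its curling numbers in the
  search \<open>explore\<close>, and the third permits the copying of squares.\<close>

definition sound :: "nat list \<Rightarrow> bool" where
  "sound r \<longleftrightarrow> (\<exists>n\<in>set states. matches r (state_letters n) (state_curls n)) \<and>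
     admissible (marked r) \<and> short_squares r"

lemma step_letter_sound:
  assumes step: "step_letter s t" and f: "naming f" and pre: "prefix (map f s) (R @ [3])"
    and t: "prefix t (marked r)" and R: "R = a # r" and good: "good R" and letters: "3 \<notin> set R"
    and s: "s \<noteq> []" "hd s \<noteq> Lstart"
    and adm: "admissible (marked r)" and short: "short_squares r"
    and explored: "repetitive (Two # marked r) \<or> long_squares_ok (marked r)"
  shows "sound R"
proof -
  have agree: "rep p m R" if "agree m s (drop p s)" "1 \<le> p" "1 \<le> m" for p m
  proof -
    have "agree m (map f s) (drop p (map f s))"
      using that(1) f by (simp add: drop_map agree_map naming_def)
    from agree_marked[OF this pre letters that(2,3)] show ?thesis .
  qed
  have finish: "sound R"
    if "enters s c" "prefix c (marked R)"
      "\<And>p. rep p p R \<Longrightarrow> \<exists>q. rep q q R \<and> q + q \<le> square_bound (marked R)" for c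
  proof -
    note m = enters_matches[OF that(1) f pre that(2) s]
    have "\<not> repetitive (marked R)"
      using repetitive_not_good[of "marked R" R] good by auto
    then have "admissible (marked R)"
      unfolding admissible_def
    proof (intro allI)
      fix k show "\<not> repetitive (drop k (marked R)) \<and> \<not> prefix_of_some avoided (drop k (marked R))"
        using \<open>\<not> repetitive (marked R)\<close> m(1) adm
        by (cases k) (auto simp: R marked_Cons admissible_def)
    qed
    moreover have "short_squares R" unfolding R by (rule short_squares_Cons[OF short that(3)[unfolded R]])
    ultimately show ?thesis using m(2) by (simp add: sound_def)
  qed
  have two: "prefix (Two # t) (marked R)" if "rep p p R" for p
    using that t by (auto simp: R marked_Cons)
  have one: "prefix (One # t) (marked R)" if "\<And>p. \<not> rep p p R"
    using that t by (auto simp: R marked_Cons)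
  have nonrep: "\<not> repetitive u" if "prefix u (marked R)" for u
    using repetitive_not_good[OF _ that] good by auto
  have no_overlap: "\<not> some_agree overlap_lags s s"
  proof
    assume "some_agree overlap_lags s s"
    then obtain p m where "(p, m) \<in> set (lags 0 overlap_lags)" "agree m s (drop p s)"
      using some_agreeD[of overlap_lags s 0] by auto
    then have "rep p (Suc p) (drop 0 R)" using overlap_lags[of p m] agree[of m p] by auto
    then show False using good unfolding good_def by blast
  qed
  show ?thesis
  proof (cases "some_agree square_lags s s")
    case True
    then obtain p m where "(p, m) \<in> set (lags 0 square_lags)" "agree m s (drop p s)"
      using some_agreeD[of square_lags s 0] by auto
    then have "rep p p R" using square_lags[of p m] agree[of m p] by auto
    note two = two[OF this]
    have sh: "some_short_agree (square_bound (Two # t)) square_lags s s" and ent: "enters s (Two # t)"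
      using step no_overlap True nonrep[OF two] unfolding step_letter_def by (auto split: if_splits)
    obtain p' m' where pm: "(p', m') \<in> set (lags 0 square_lags)" "agree m' s (drop p' s)"
        "m' + m' \<le> square_bound (Two # t)"
      using some_short_agreeD[of "square_bound (Two # t)" square_lags s 0] sh by auto
    then have "rep p' p' R" "p' + p' \<le> square_bound (Two # t)"
      using square_lags[OF pm(1)] agree[of m' p'] by auto
    then show ?thesis
      using finish[OF ent two] square_bound_mono[OF two] order_trans by blast
  next
    case False
    have none: "\<not> rep p p R" for p
    proof
      assume sq: "rep p p R"
      have nr: "\<not> repetitive (Two # t)" using nonrep two[OF sq] by blast
      have ap: "all_apart short_lags s s" and wo: "windows_ok windows s t"
        using step no_overlap False nr unfolding step_letter_def by (auto split: if_splits)
      have small: "\<not> rep q q R" if "q \<le> 12" for q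
      proof (cases "1 \<le> q")
        case True
        have "apart q s (drop q s)"
          using all_apartD[of short_lags s 0] ap short_lags[OF True that] by simp
        from apart_no_square[OF this f pre letters] show ?thesis .
      qed (simp add: rep_def)
      have "marked R = Two # marked r" using sq by (auto simp: R marked_Cons)
      then have "\<not> repetitive (Two # marked r)" using nonrep[of "marked R"] by simp
      \<comment> \<open>The search guarantees this unless \<open>Two\<close> would be repetitive,
        and the assumed square makes \<open>Two\<close> the actual curling number of a good
        word.\<close>
      then have "long_ok (marked r) 12 (drop 12 (marked r))"
        using explored by (simp add: long_squares_ok_def)
      moreover have "12 < p" using small[of p] sq by force
      ultimately have "listed windows p (marked r)"
        using long_ok_sound[OF sq[unfolded R] short, of 12] small unfolding R by blast
      then obtain us u where u: "(p, us) \<in> set windows" "u \<in> set us" "prefix u (marked r)"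
        using listedD by blast
      \<comment> \<open>A window that really occurs cannot be parallel to the known beginning
        \<open>t\<close>, so the state must show two different letters at distance
        \<open>p\<close>.\<close>
      then have "disagree p s (drop p s)"
        using windows_okD[OF wo u(1,2)] parallel_prefix[OF _ t] by blast
      then have "disagree p (map f s) (drop p (map f s))"
        using f by (simp add: drop_map disagree_map naming_def)
      from disagree_marked[OF this order_refl pre] sq show False by contradiction
    qed
    note one = one[OF none]
    have "enters s (One # t)"
      using step no_overlap False nonrep[OF one] unfolding step_letter_def by (auto split: if_splits)
    then show ?thesis using finish[OF _ one] none by blast
  qed
qed

lemma sound_Cons:
  assumes steps: "\<forall>n\<in>set states. step (state_letters n) (state_curls n)"
    and expl: "explore 85 [Start]"
    and "sound r" "good (a # r)" "set (a # r) \<subseteq> {0, 1, 2}"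
  shows "sound (a # r)"
proof -
  obtain n f where n: "n \<in> set states" and f: "naming f"
    and pre: "prefix (map f (state_letters n)) (r @ [3])" and t: "prefix (state_curls n) (marked r)"
    using assms(3) by (auto simp: sound_def matches_def)
  have "a \<in> range f" using f assms(5) by (auto simp: naming_def)
  then obtain l where l: "a = f l" by blast
  then have ls: "l \<noteq> Lstart" using f assms(5) by (auto simp: naming_def)
  have st: "step_letter (l # state_letters n) (state_curls n)"
    using steps n ls unfolding step_def by (cases l) (auto split: if_splits)
  have adm: "admissible (marked r)" and short: "short_squares r"
    using assms(3) by (auto simp: sound_def)
  \<comment> \<open>The curling list of \<open>r\<close> is itself a node of the search tree rooted
    at \<open>[Start]\<close>.\<close>
  have ex: "repetitive (Two # marked r) \<or> long_squares_ok (marked r)"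
    using explore_sound[OF expl, of "curls r"] adm Start_notin_curls[of r] by (simp add: marked_def)
  show ?thesis
    by (rule step_letter_sound[OF st f _ t refl assms(4) _ _ _ adm short ex])
      (use pre l ls assms(5) in auto)
qed

lemma sound_if_good:
  assumes steps: "\<forall>n\<in>set states. step (state_letters n) (state_curls n)"
    and expl: "explore 85 [Start]" and start: "sound []"
    and "good r" "set r \<subseteq> {0, 1, 2}"
  shows "sound r"
  using assms(4,5)
proof (induction r)
  case (Cons a r)
  then have "sound r" using good_Cons by (metis set_subset_Cons subset_trans)
  then show ?case using sound_Cons[OF steps expl] Cons.prems by blast
qed (rule start)

section \<open>The word of length 84\<close>

lemma rep_less: "rep p m r \<Longrightarrow> m' \<le> m \<Longrightarrow> rep p m' r"
  by (auto simp: rep_def)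

text \<open>The least \<open>m\<close> with \<open>4 * p \<le> 3 * m\<close>. Testing this value
  suffices, since a longer run of the same period contains the shorter one.\<close>

definition excess :: "nat \<Rightarrow> nat" where
  "excess p = (4 * p + 2) div 3"

text \<open>Larger lags are irrelevant to repetitions in words of length at most \<open>84\<close>.\<close>

definition all_lags :: "(nat \<Rightarrow> nat) \<Rightarrow> (nat \<times> nat) list" where
  "all_lags g = map (\<lambda>p. (1, g p)) [1..<43]"

fun curls_by :: "(nat \<times> nat) list \<Rightarrow> 'a list \<Rightarrow> curl list" where
  "curls_by ps [] = []"
| "curls_by ps (a # r) = (if some_agree ps (a # r) (a # r) then Two else One) # curls_by ps r"

fun free_of :: "(nat \<times> nat) list \<Rightarrow> 'a list \<Rightarrow> bool" where
  "free_of ps [] = True"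
| "free_of ps (a # r) = (if some_agree ps (a # r) (a # r) then False else free_of ps r)"

lemma some_agreeI:
  "(k + p, m) \<in> set (lags k ps) \<Longrightarrow> agree m t (drop (k + p) t) \<Longrightarrow> some_agree ps t (drop k t)"
proof (induction ps arbitrary: k p)
  case (Cons dm ps)
  obtain d m' where dm: "dm = (d, m')" by force
  \<comment> \<open>Lags accumulate, so all lags produced from \<open>j\<close> on are at least
    \<open>j\<close>; this is what allows \<open>p\<close> to be split as \<open>d + e\<close>
    below.\<close>
  have le: "j \<le> q" if "(q, i) \<in> set (lags j qs)" for q i j qs
    using that by (induction qs arbitrary: j) fastforce+
  show ?case
  proof (cases "(k + p, m) = (k + d, m')")
    case True
    then show ?thesis using Cons.prems(2) by (simp add: dm add.commute)
  next
    case False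
    then have mem: "(k + p, m) \<in> set (lags (k + d) ps)" using Cons.prems(1) by (auto simp: dm)
    then obtain e where "p = d + e" using le le_Suc_ex by (metis add.assoc add_left_cancel)
    then have "some_agree ps t (drop (k + d) t)"
      using Cons.IH[of "k + d" e] mem Cons.prems(2) by (simp add: add.assoc)
    then show ?thesis by (simp add: dm add.commute)
  qed
qed simp

lemma lags_steps: "lags k (map (\<lambda>p. (1, g p)) [Suc k..<n]) = map (\<lambda>p. (p, g p)) [Suc k..<n]"
proof (induction "n - k" arbitrary: k)
  case (Suc i)
  show ?case
  proof (cases "Suc k < n")
    case True
    then have "[Suc k..<n] = Suc k # [Suc (Suc k)..<n]" by (rule upt_conv_Cons)
    moreover have "i = n - Suc k" using Suc by simp
    ultimately show ?thesis using Suc.hyps(1)[of "Suc k"] by simp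
  qed simp
qed simp

lemma some_agree_all_lags:
  assumes "rep p (g p) r" "p < 43" "1 \<le> g p"
  shows "some_agree (all_lags g) r r"
proof -
  have p: "1 \<le> p" using assms(1) by (simp add: rep_def)
  then have "(0 + p, g p) \<in> set (lags 0 (all_lags g))"
    using lags_steps[of 0 g 43] assms(2) by (simp add: all_lags_def image_iff)
  moreover have "agree (g p) r (drop (0 + p) r)"
    using rep_iff_agree[OF p assms(3), of r] assms(1) by simp
  ultimately show ?thesis using some_agreeI[of 0 p "g p" "all_lags g" r] by simp
qed

lemma some_agree_all_lagsD:
  assumes "some_agree (all_lags (\<lambda>p. p)) r r"
  shows "\<exists>p. rep p p r"
proof -
  obtain p where "1 \<le> p" "agree p r (drop p r)"
    using some_agreeD[of "all_lags (\<lambda>p. p)" r 0] assms lags_steps[of 0 "\<lambda>p. p" 43]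
    by (auto simp: all_lags_def)
  then show ?thesis using rep_iff_agree[of p p r] by blast
qed

text \<open>The curling numbers of the example must be exact, so here the test for squares is used
  in both directions.\<close>

lemma curls_by:
  "length r \<le> 84 \<Longrightarrow> curls_by (all_lags (\<lambda>p. p)) r = curls r"
proof (induction r)
  case (Cons a r)
  have "p < 43 \<and> 1 \<le> p" if "rep p p (a # r)" for p
    using that Cons.prems by (simp add: rep_def)
  then have "some_agree (all_lags (\<lambda>p. p)) (a # r) (a # r) \<longleftrightarrow> (\<exists>p. rep p p (a # r))"
    using some_agree_all_lags[of _ "\<lambda>p. p" "a # r"] some_agree_all_lagsD by blast
  then show ?case using Cons by simp
qed simp

text \<open>A repetition with \<open>p \<le> g p\<close> occupies at least \<open>2 * p\<close>
  letters, so in a word of length at most 84 its lag is among the tested ones, 1 to 42.\<close>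

lemma free_of_sound:
  assumes "free_of (all_lags g) r" "length r \<le> 84" "\<And>p. 1 \<le> p \<Longrightarrow> p \<le> g p"
  shows "\<not> rep p (g p) (drop k r)"
  using assms(1,2)
proof (induction r arbitrary: k)
  case Nil
  then show ?case by (simp add: rep_def)
next
  case (Cons a r)
  show ?case
  proof (cases k)
    case 0
    show ?thesis
    proof
      assume "rep p (g p) (drop k (a # r))"
      then have rep: "rep p (g p) (a # r)" using 0 by simp
      then have "1 \<le> p" "g p + p \<le> 84" using Cons.prems(2) by (simp_all add: rep_def)
      then have "p < 43" "1 \<le> g p" using assms(3)[of p] by simp_all
      then show False using some_agree_all_lags[of p g "a # r"] rep Cons.prems(1) by simp
    qed
  next
    case (Suc k')
    then show ?thesis using Cons by (simp split: if_splits)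
  qed
qed

lemma goodI:
  assumes "length r \<le> 84" "free_of (all_lags Suc) r"
    "free_of (all_lags excess) (curls_by (all_lags (\<lambda>p. p)) r)"
  shows "good r"
  unfolding good_def
proof (intro conjI allI impI)
  fix k p show "\<not> rep p (Suc p) (drop k r)"
    using free_of_sound[OF assms(2,1)] by simp
next
  fix k p m :: nat assume "4 * p \<le> 3 * m"
  then have "excess p \<le> m" by (simp add: excess_def)
  moreover have "\<not> rep p (excess p) (drop k (curls r))"
    using free_of_sound[OF assms(3)] assms(1) by (simp add: curls_by excess_def)
  ultimately show "\<not> rep p m (drop k (curls r))" using rep_less by blast
qed

text \<open>For evaluation, numbers other than the codes of the states above are written in unary, so that
  every test runs by rewriting with equations that match the outermost constructors.\<close>

lemmas unary = eval_nat_numeral BitM.simps One_nat_def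

text \<open>Comparisons are decided by matching: identical heads by a repeated variable, distinct
  constructors by \<open>agree_neq\<close>, and unary numbers after peeling off successors by
  \<open>agree_Suc\<close>.\<close>

lemma agree_refl: "agree (Suc n) (a # u) (a # v) = agree n u v"
  and agree_neq: "a \<noteq> b \<Longrightarrow> agree (Suc n) (a # u) (b # v) = False"
  and agree_Suc: "agree (Suc n) (Suc i # s) (Suc j # t) = agree (Suc n) (i # s) (j # t)"
  and agree_Nil: "agree (Suc n) [] v = False" "agree (Suc n) u [] = False"
  by simp_all

lemmas agree_eval = agree.simps(1) agree_Nil agree_refl nat.distinct[THEN agree_neq] agree_Suc
  curl.distinct[THEN agree_neq]

lemma upt_43: "[1..<43] = 1 # [2..<43::nat]"
  by (subst upt_conv_Cons) (simp_all add: numeral_2_eq_2)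

lemma all_lags_excess: "all_lags excess = map (\<lambda>p. (1, (4 * p + 2) div 3)) [1..<43]"
  by (simp add: all_lags_def excess_def)

lemmas all_lags_eval =
  all_lags_def[of Suc, unfolded upt_43, simplified, unfolded unary]
  all_lags_def[of "\<lambda>p. p", unfolded upt_43, simplified, unfolded unary]
  all_lags_excess[unfolded upt_43, simplified, unfolded unary]

definition word84 :: "nat list" where
  "word84 = [0, 1, 1, 0, 1, 0, 0, 1, 0, 2, 0, 0, 2, 0, 2, 1, 2, 1, 1, 0, 0, 2, 0, 0, 2, 1, 0, 0, 2, 1,
    1, 0, 1, 0, 0, 1, 0, 2, 0, 0, 2, 0, 2, 1, 1, 0, 1, 1, 0, 2, 0, 0, 2, 0, 2, 1, 2, 1, 1, 0,
    0, 2, 0, 0, 2, 1, 0, 0, 2, 1, 1, 2, 2, 0, 1, 1, 2, 2, 0, 2, 1, 1, 0, 0]"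

lemmas word84_eval = word84_def[unfolded unary]

lemma good_word84: "good (rev word84)"
proof (rule goodI)
  show "length (rev word84) \<le> 84" by (simp add: word84_def)
  show "free_of (all_lags Suc) (rev word84)"
    \<comment> \<open>\<open>if_weak_cong\<close> lets only the condition be simplified before a
      branch is chosen. Tests written with \<open>if\<close> in place of logical connectives thus
      stop at the first answer.\<close>
    by (simp only: word84_eval rev.simps append.simps all_lags_eval free_of.simps some_agree.simps
        agree_eval drop_0 drop_Nil drop_Suc_Cons if_True if_False cong: if_weak_cong)
  show "free_of (all_lags excess) (curls_by (all_lags (\<lambda>p. p)) (rev word84))"
    by (simp only: word84_eval rev.simps append.simps all_lags_eval free_of.simps
        curls_by.simps some_agree.simps agree_eval drop_0 drop_Nil drop_Suc_Cons if_True if_False cong: if_weak_cong)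
qed

lemma word84: "length word84 = 84" "set word84 \<subseteq> {0, 1, 2}"
  by (simp_all add: word84_def)

section \<open>Evaluation\<close>

lemma disagree_refl: "disagree (Suc n) (a # u) (a # v) = disagree n u v"
  and disagree_neq: "a \<noteq> b \<Longrightarrow> disagree (Suc n) (a # u) (b # v) = True"
  and disagree_Nil: "disagree 0 u v = False" "disagree n [] v = False" "disagree n u [] = False"
  by (simp, simp, simp_all only: disagree_iff) auto

lemma prefix_refl: "prefix (a # u) (a # v) = prefix u v"
  and prefix_neq: "a \<noteq> b \<Longrightarrow> prefix (a # u) (b # v) = False"
  and prefix_Nil: "prefix [] v = True" "prefix (a # u) [] = False"
  by simp_all

lemma parallel_refl: "parallel (a # u) (a # v) = parallel u v"
  and parallel_neq: "a \<noteq> b \<Longrightarrow> parallel (a # u) (b # v) = True"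
  and parallel_Nil: "parallel [] v = False" "parallel u [] = False"
  by (auto simp: parallel_def)

lemma less_eq_unary: "(0::nat) \<le> n \<longleftrightarrow> True" "Suc m \<le> Suc n \<longleftrightarrow> m \<le> n" "Suc m \<le> 0 \<longleftrightarrow> False"
  by simp_all

lemmas test_eval = agree.simps(1) agree_Nil agree_refl
  letter.distinct[THEN agree_neq] curl.distinct[THEN agree_neq]
  disagree_Nil disagree_refl letter.distinct[THEN disagree_neq]
  prefix_Nil prefix_refl curl.distinct[THEN prefix_neq]
  parallel_Nil parallel_refl curl.distinct[THEN parallel_neq]
  less_eq_unary drop_0 drop_Nil drop_Suc_Cons
  some_agree.simps repetitive_def curl_lags_def[unfolded unary]
  square_bound_def[unfolded unary] if_True if_False simp_thms

lemmas explore_eval = test_eval refuted.simps prefix_of_some.simps windows_def[unfolded unary]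
  listed.simps nat.inject nat.distinct long_ok.simps avoided_def
  long_squares_ok_def[unfolded unary] explore.simps

text \<open>The depth is 85 because a list with 84 curling numbers is still visited, and the last
  unit is spent on finding both of its extensions excluded.\<close>

lemma explore_Start: "explore 85 [Start]"
  unfolding unary by (simp only: explore_eval cong: if_weak_cong)

text \<open>With arbitrary \<open>u\<close> and \<open>v\<close>, each code becomes a rewrite rule
  whose left side is the expanded state followed by an unknown rest. Finding a covering state is
  then a pattern match in place of a search through the list.\<close>

lemma covered_states:
  assumes "set c \<subseteq> set states"
  shows "list_all (\<lambda>n. \<forall>u v. covered (state_letters n @ u) (state_curls n @ v)) c"
  unfolding list_all_iff covered_def
proof (intro ballI allI)
  fix n u v assume "n \<in> set c"
  then show "\<exists>m\<in>set states. prefix (state_letters m) (state_letters n @ u) \<and>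
      prefix (state_curls m) (state_curls n @ v)"
    using assms by (intro bexI[of _ n]) auto
qed

lemmas state_eval = state_letters_def state_curls_def num_of_nat_numeral_eq
  letters_num.simps curls_num.simps curls_bits.simps append.simps list.pred_inject

lemma covered_states1:
  "list_all (\<lambda>n. \<forall>u v. covered (state_letters n @ u) (state_curls n @ v)) states1"
  by (rule covered_states) (auto simp: states_def)

lemmas covered_eval1 = covered_states1[unfolded states1_def state_eval]

lemma covered_states2:
  "list_all (\<lambda>n. \<forall>u v. covered (state_letters n @ u) (state_curls n @ v)) states2"
  by (rule covered_states) (auto simp: states_def)

lemmas covered_eval2 = covered_states2[unfolded states2_def state_eval]

lemma covered_states3:
  "list_all (\<lambda>n. \<forall>u v. covered (state_letters n @ u) (state_curls n @ v)) states3"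
  by (rule covered_states) (auto simp: states_def)

lemmas covered_eval3 = covered_states3[unfolded states3_def state_eval]

lemma covered_states4:
  "list_all (\<lambda>n. \<forall>u v. covered (state_letters n @ u) (state_curls n @ v)) states4"
  by (rule covered_states) (auto simp: states_def)

lemmas covered_eval4 = covered_states4[unfolded states4_def state_eval]

lemma covered_states5:
  "list_all (\<lambda>n. \<forall>u v. covered (state_letters n @ u) (state_curls n @ v)) states5"
  by (rule covered_states) (auto simp: states_def)

lemmas covered_eval5 = covered_states5[unfolded states5_def state_eval]

lemma covered_states6:
  "list_all (\<lambda>n. \<forall>u v. covered (state_letters n @ u) (state_curls n @ v)) states6"
  by (rule covered_states) (auto simp: states_def)

lemmas covered_eval6 = covered_states6[unfolded states6_def state_eval]

lemma covered_states7:
  "list_all (\<lambda>n. \<forall>u v. covered (state_letters n @ u) (state_curls n @ v)) states7"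
  by (rule covered_states) (auto simp: states_def)

lemmas covered_eval7 = covered_states7[unfolded states7_def state_eval]

lemma covered_states8:
  "list_all (\<lambda>n. \<forall>u v. covered (state_letters n @ u) (state_curls n @ v)) states8"
  by (rule covered_states) (auto simp: states_def)

lemmas covered_eval8 = covered_states8[unfolded states8_def state_eval]

lemma covered_states9:
  "list_all (\<lambda>n. \<forall>u v. covered (state_letters n @ u) (state_curls n @ v)) states9"
  by (rule covered_states) (auto simp: states_def)

lemmas covered_eval9 = covered_states9[unfolded states9_def state_eval]

lemma covered_states10:
  "list_all (\<lambda>n. \<forall>u v. covered (state_letters n @ u) (state_curls n @ v)) states10"
  by (rule covered_states) (auto simp: states_def)

lemmas covered_eval10 = covered_states10[unfolded states10_def state_eval]

lemma covered_states11:
  "list_all (\<lambda>n. \<forall>u v. covered (state_letters n @ u) (state_curls n @ v)) states11"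
  by (rule covered_states) (auto simp: states_def)

lemmas covered_eval11 = covered_states11[unfolded states11_def state_eval]

lemma covered_states12:
  "list_all (\<lambda>n. \<forall>u v. covered (state_letters n @ u) (state_curls n @ v)) states12"
  by (rule covered_states) (auto simp: states_def)

lemmas covered_eval12 = covered_states12[unfolded states12_def state_eval]

lemma covered_states13:
  "list_all (\<lambda>n. \<forall>u v. covered (state_letters n @ u) (state_curls n @ v)) states13"
  by (rule covered_states) (auto simp: states_def)

lemmas covered_eval13 = covered_states13[unfolded states13_def state_eval]

lemma covered_states14:
  "list_all (\<lambda>n. \<forall>u v. covered (state_letters n @ u) (state_curls n @ v)) states14"
  by (rule covered_states) (auto simp: states_def)

lemmas covered_eval14 = covered_states14[unfolded states14_def state_eval]

lemma covered_states15:
  "list_all (\<lambda>n. \<forall>u v. covered (state_letters n @ u) (state_curls n @ v)) states15"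
  by (rule covered_states) (auto simp: states_def)

lemmas covered_eval15 = covered_states15[unfolded states15_def state_eval]

lemma covered_states16:
  "list_all (\<lambda>n. \<forall>u v. covered (state_letters n @ u) (state_curls n @ v)) states16"
  by (rule covered_states) (auto simp: states_def)

lemmas covered_eval16 = covered_states16[unfolded states16_def state_eval]

lemma covered_states17:
  "list_all (\<lambda>n. \<forall>u v. covered (state_letters n @ u) (state_curls n @ v)) states17"
  by (rule covered_states) (auto simp: states_def)

lemmas covered_eval17 = covered_states17[unfolded states17_def state_eval]

lemma covered_states18:
  "list_all (\<lambda>n. \<forall>u v. covered (state_letters n @ u) (state_curls n @ v)) states18"
  by (rule covered_states) (auto simp: states_def)

lemmas covered_eval18 = covered_states18[unfolded states18_def state_eval]

lemma covered_states19:
  "list_all (\<lambda>n. \<forall>u v. covered (state_letters n @ u) (state_curls n @ v)) states19"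
  by (rule covered_states) (auto simp: states_def)

lemmas covered_eval19 = covered_states19[unfolded states19_def state_eval]

lemma covered_states20:
  "list_all (\<lambda>n. \<forall>u v. covered (state_letters n @ u) (state_curls n @ v)) states20"
  by (rule covered_states) (auto simp: states_def)

lemmas covered_eval20 = covered_states20[unfolded states20_def state_eval]

lemma covered_states21:
  "list_all (\<lambda>n. \<forall>u v. covered (state_letters n @ u) (state_curls n @ v)) states21"
  by (rule covered_states) (auto simp: states_def)

lemmas covered_eval21 = covered_states21[unfolded states21_def state_eval]

lemma covered_states22:
  "list_all (\<lambda>n. \<forall>u v. covered (state_letters n @ u) (state_curls n @ v)) states22"
  by (rule covered_states) (auto simp: states_def)

lemmas covered_eval22 = covered_states22[unfolded states22_def state_eval]

lemma covered_states23:
  "list_all (\<lambda>n. \<forall>u v. covered (state_letters n @ u) (state_curls n @ v)) states23"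
  by (rule covered_states) (auto simp: states_def)

lemmas covered_eval23 = covered_states23[unfolded states23_def state_eval]

lemma covered_states24:
  "list_all (\<lambda>n. \<forall>u v. covered (state_letters n @ u) (state_curls n @ v)) states24"
  by (rule covered_states) (auto simp: states_def)

lemmas covered_eval24 = covered_states24[unfolded states24_def state_eval]

lemma covered_states25:
  "list_all (\<lambda>n. \<forall>u v. covered (state_letters n @ u) (state_curls n @ v)) states25"
  by (rule covered_states) (auto simp: states_def)

lemmas covered_eval25 = covered_states25[unfolded states25_def state_eval]

lemma covered_states26:
  "list_all (\<lambda>n. \<forall>u v. covered (state_letters n @ u) (state_curls n @ v)) states26"
  by (rule covered_states) (auto simp: states_def)

lemmas covered_eval26 = covered_states26[unfolded states26_def state_eval]

lemma covered_states27:
  "list_all (\<lambda>n. \<forall>u v. covered (state_letters n @ u) (state_curls n @ v)) states27"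
  by (rule covered_states) (auto simp: states_def)

lemmas covered_eval27 = covered_states27[unfolded states27_def state_eval]

lemma covered_states28:
  "list_all (\<lambda>n. \<forall>u v. covered (state_letters n @ u) (state_curls n @ v)) states28"
  by (rule covered_states) (auto simp: states_def)

lemmas covered_eval28 = covered_states28[unfolded states28_def state_eval]

lemma covered_states29:
  "list_all (\<lambda>n. \<forall>u v. covered (state_letters n @ u) (state_curls n @ v)) states29"
  by (rule covered_states) (auto simp: states_def)

lemmas covered_eval29 = covered_states29[unfolded states29_def state_eval]

lemma covered_states30:
  "list_all (\<lambda>n. \<forall>u v. covered (state_letters n @ u) (state_curls n @ v)) states30"
  by (rule covered_states) (auto simp: states_def)

lemmas covered_eval30 = covered_states30[unfolded states30_def state_eval]

lemma covered_states31:
  "list_all (\<lambda>n. \<forall>u v. covered (state_letters n @ u) (state_curls n @ v)) states31"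
  by (rule covered_states) (auto simp: states_def)

lemmas covered_eval31 = covered_states31[unfolded states31_def state_eval]

lemma covered_states32:
  "list_all (\<lambda>n. \<forall>u v. covered (state_letters n @ u) (state_curls n @ v)) states32"
  by (rule covered_states) (auto simp: states_def)

lemmas covered_eval32 = covered_states32[unfolded states32_def state_eval]

lemma covered_states33:
  "list_all (\<lambda>n. \<forall>u v. covered (state_letters n @ u) (state_curls n @ v)) states33"
  by (rule covered_states) (auto simp: states_def)

lemmas covered_eval33 = covered_states33[unfolded states33_def state_eval]

lemmas covered_eval = covered_eval1 covered_eval2 covered_eval3 covered_eval4 covered_eval5 covered_eval6
  covered_eval7 covered_eval8 covered_eval9 covered_eval10 covered_eval11 covered_eval12
  covered_eval13 covered_eval14 covered_eval15 covered_eval16 covered_eval17 covered_eval18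
  covered_eval19 covered_eval20 covered_eval21 covered_eval22 covered_eval23 covered_eval24
  covered_eval25 covered_eval26 covered_eval27 covered_eval28 covered_eval29 covered_eval30
  covered_eval31 covered_eval32 covered_eval33

section \<open>Closure of the list of states\<close>

definition closed_state :: "nat \<Rightarrow> bool" where
  "closed_state n \<longleftrightarrow> step (state_letters n) (state_curls n)"

lemmas step_eval = closed_state_def test_eval state_eval some_short_agree.simps add_0 add_Suc
  has_start.simps apart.simps all_apart.simps short_lags_def[unfolded unary]
  square_lags_def[unfolded unary] overlap_lags_def[unfolded unary]
  all_parallel.simps windows_def[unfolded unary] windows_ok.simps avoided_def
  next_letter.simps second_letter.simps rename_def canonical_def list.map list.sel(1)
  letter.distinct enters_def step_letter_def step_def

lemma closed_states_1_to_11: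
  "list_all closed_state states1"
  "list_all closed_state states2"
  "list_all closed_state states3"
  "list_all closed_state states4"
  "list_all closed_state states5"
  "list_all closed_state states6"
  "list_all closed_state states7"
  "list_all closed_state states8"
  "list_all closed_state states9"
  "list_all closed_state states10"
  "list_all closed_state states11"
  by (simp_all only: states1_def states2_def states3_def states4_def states5_def states6_def states7_def
      states8_def states9_def states10_def states11_def
      step_eval covered_eval cong: if_weak_cong)

lemma closed_states_12_to_22:
  "list_all closed_state states12"
  "list_all closed_state states13"
  "list_all closed_state states14"
  "list_all closed_state states15"
  "list_all closed_state states16"
  "list_all closed_state states17"
  "list_all closed_state states18"
  "list_all closed_state states19"
  "list_all closed_state states20"
  "list_all closed_state states21"
  "list_all closed_state states22"
  by (simp_all only: states12_def states13_def states14_def states15_def states16_def states17_def states18_def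
      states19_def states20_def states21_def states22_def
      step_eval covered_eval cong: if_weak_cong)

lemma closed_states_23_to_33:
  "list_all closed_state states23"
  "list_all closed_state states24"
  "list_all closed_state states25"
  "list_all closed_state states26"
  "list_all closed_state states27"
  "list_all closed_state states28"
  "list_all closed_state states29"
  "list_all closed_state states30"
  "list_all closed_state states31"
  "list_all closed_state states32"
  "list_all closed_state states33"
  by (simp_all only: states23_def states24_def states25_def states26_def states27_def states28_def states29_def
      states30_def states31_def states32_def states33_def
      step_eval covered_eval cong: if_weak_cong)

lemma step_states: "\<forall>n\<in>set states. step (state_letters n) (state_curls n)"
proof -
  have "list_all closed_state states"
    unfolding states_def list_all_append
    by (intro conjI closed_states_1_to_11 closed_states_12_to_22 closed_states_23_to_33)
  then show ?thesis by (simp add: list_all_iff closed_state_def)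
qed

section \<open>The empty word and the length bound\<close>

lemma sound_Nil: "sound []"
proof -
  define f where "f l = (case l of La \<Rightarrow> 0 | Lb \<Rightarrow> 1 | Lc \<Rightarrow> 2 | Lstart \<Rightarrow> (3::nat))" for l
  have "inj f" by (rule injI) (auto simp: f_def split: letter.splits)
  moreover have "range f = {0, 1, 2, 3}"
  proof
    show "{0, 1, 2, 3} \<subseteq> range f"
      using rangeI[of f La] rangeI[of f Lb] rangeI[of f Lc] rangeI[of f Lstart] by (simp add: f_def)
  qed (auto simp: f_def split: letter.splits)
  ultimately have "naming f" by (simp add: naming_def f_def)
  \<comment> \<open>In binary 31 is \<open>11111\<close>: two bits end the empty list of letters,
    two set both end markers, and the leading bit ends the empty list of curling numbers.\<close>
  have "31 \<in> set states" by (simp add: states_def states1_def)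
  moreover have "matches [] (state_letters 31) (state_curls 31)"
    using \<open>naming f\<close> by (auto simp: matches_def state_eval naming_def)
  moreover have "admissible [Start]"
    unfolding admissible_def
  proof
    fix k show "\<not> repetitive (drop k [Start]) \<and> \<not> prefix_of_some avoided (drop k [Start])"
      by (cases k) (simp_all add: repetitive_def curl_lags_def avoided_def unary)
  qed
  moreover have "short_squares []" by (simp add: short_squares_def rep_def)
  ultimately show ?thesis by (auto simp: sound_def)
qed

lemma good_length:
  fixes r :: "nat list"
  assumes "good r" "set r \<subseteq> {0, 1, 2}"
  shows "length r \<le> 84"
proof -
  have "admissible (curls r @ [Start])"
    using sound_if_good[OF step_states explore_Start sound_Nil assms] by (simp add: sound_def marked_def)
  then have "length (curls r) < 85"
    using explore_sound[OF explore_Start] Start_notin_curls by blast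
  then show ?thesis by simp
qed

theorem theorem11:
  shows "(\<exists>x :: nat list. set x \<subseteq> {0, 1, 2} \<and> length x = 84 \<and>
             overlap_free x \<and> exponent_free (7/3) (curling_transform x)) \<and>
         \<not> (\<exists>x :: nat list. set x \<subseteq> {0, 1, 2} \<and> length x > 84 \<and>
             overlap_free x \<and> exponent_free (7/3) (curling_transform x))"
proof (intro conjI notI)
  show "\<exists>x :: nat list. set x \<subseteq> {0, 1, 2} \<and> length x = 84 \<and>
      overlap_free x \<and> exponent_free (7/3) (curling_transform x)"
    using good_word84 word84 unfolding good_iff by blast
next
  assume "\<exists>x :: nat list. set x \<subseteq> {0, 1, 2} \<and> length x > 84 \<and>
      overlap_free x \<and> exponent_free (7/3) (curling_transform x)"
  then obtain x :: "nat list" where "set x \<subseteq> {0, 1, 2}" "length x > 84" "good (rev x)"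
    unfolding good_iff by blast
  then show False using good_length[of "rev x"] by simp
qed

end
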